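(* Let $\mathcal{H}$ be an irreducible complete Pick reproducing kernel Hilbert space of analytic functions on $\mathbb{D}$ with kernel $k$. Suppose $\frac{1}{k(0,0)}-\frac{1}{k(z,w)}=q(z\bar w)$ for a rational function $q$ with $q'(0)\neq0$. If $\mathcal{H}$ does not extend to a larger disc, then $\mathcal{H}=H^2(\mathbb{D})$ with equivalent norms.
   Context: $\mathbb{D}$ is the open unit disc and $H^2(\mathbb{D})$ the Hardy space. An RKHS is irreducible if its kernel never vanishes. It is complete Pick if for every $m\ge1$, points $\lambda_1,\dots,\lambda_n$ and matrices $A_1,\dots,A_n\in M_m(\mathbb{C})$, positivity of $[(1-A_jA_k^* )k(\lambda_j,\lambda_k)]_{j,k}$ implies existence of an $m\times m$ multiplier $F$ of norm $\le1$ with $F(\lambda_j)=A_j$. "$\mathcal{H}$ does not extend to a larger disc" means there is no $R>1$ such that the kernel $k$ extends to $R\mathbb{D}\times R\mathbb{D}$, analytic in the first variable and anti-analytic in the second. *)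

theory Defs
  imports "HOL-Complex_Analysis.Complex_Analysis" "HOL-Computational_Algebra.Polynomial"
begin

abbreviation unit_disc :: "complex set" where "unit_disc \<equiv> ball 0 1"

definition pos_kernel :: "'a set \<Rightarrow> ('a \<Rightarrow> 'a \<Rightarrow> complex) \<Rightarrow> bool" where
  "pos_kernel X K \<longleftrightarrow>
     (\<forall>(n::nat) (x::nat \<Rightarrow> 'a) (c::nat \<Rightarrow> complex). (\<forall>i<n. x i \<in> X) \<longrightarrow>
        (let s = (\<Sum>i<n. \<Sum>j<n. c i * cnj (c j) * K (x i) (x j)) in Im s = 0 \<and> Re s \<ge> 0))"

text \<open>The reproducing kernel Hilbert space H(K) on X (Aronszajn): f belongs to H(K) iff
  c K - f \<otimes> f^* is a positive kernel for some c \<ge> 0; functions are taken to vanish off X.\<close>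
definition rkhs :: "('a \<Rightarrow> 'a \<Rightarrow> complex) \<Rightarrow> 'a set \<Rightarrow> ('a \<Rightarrow> complex) set" where
  "rkhs K X = {f. (\<forall>x. x \<notin> X \<longrightarrow> f x = 0) \<and>
      (\<exists>c::real. c \<ge> 0 \<and> pos_kernel X (\<lambda>x y. of_real c * K x y - f x * cnj (f y)))}"

definition rkhs_norm :: "('a \<Rightarrow> 'a \<Rightarrow> complex) \<Rightarrow> 'a set \<Rightarrow> ('a \<Rightarrow> complex) \<Rightarrow> real" where
  "rkhs_norm K X f = Inf {sqrt c | c. c \<ge> 0 \<and> pos_kernel X (\<lambda>x y. of_real c * K x y - f x * cnj (f y))}"

definition H2 :: "(complex \<Rightarrow> complex) set" where
  "H2 = {f. f holomorphic_on unit_disc \<and> (\<forall>z. z \<notin> unit_disc \<longrightarrow> f z = 0) \<and>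
            summable (\<lambda>n. (cmod ((deriv ^^ n) f 0 / of_nat (fact n)))\<^sup>2)}"

definition H2_norm :: "(complex \<Rightarrow> complex) \<Rightarrow> real" where
  "H2_norm f = sqrt (\<Sum>n. (cmod ((deriv ^^ n) f 0 / of_nat (fact n)))\<^sup>2)"

text \<open>Amplification k \<otimes> I_m: the kernel of H \<otimes> C^m, realised on D \<times> {0..<m}.\<close>
definition ampl_kernel :: "(complex \<Rightarrow> complex \<Rightarrow> complex) \<Rightarrow> (complex \<times> nat) \<Rightarrow> (complex \<times> nat) \<Rightarrow> complex" where
  "ampl_kernel k = (\<lambda>(z,a) (w,b). if a = b then k z w else 0)"

definition ampl_dom :: "nat \<Rightarrow> (complex \<times> nat) set" where
  "ampl_dom m = unit_disc \<times> {..<m}"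

definition mat_mult_op :: "nat \<Rightarrow> (complex \<Rightarrow> nat \<Rightarrow> nat \<Rightarrow> complex) \<Rightarrow> (complex \<times> nat \<Rightarrow> complex) \<Rightarrow> (complex \<times> nat \<Rightarrow> complex)" where
  "mat_mult_op m F f = (\<lambda>(z,a). if z \<in> unit_disc \<and> a < m then (\<Sum>b<m. F z a b * f (z,b)) else 0)"

definition contractive_multiplier :: "(complex \<Rightarrow> complex \<Rightarrow> complex) \<Rightarrow> nat \<Rightarrow> (complex \<Rightarrow> nat \<Rightarrow> nat \<Rightarrow> complex) \<Rightarrow> bool" where
  "contractive_multiplier k m F \<longleftrightarrow>
     (\<forall>f \<in> rkhs (ampl_kernel k) (ampl_dom m).
        mat_mult_op m F f \<in> rkhs (ampl_kernel k) (ampl_dom m) \<and>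
        rkhs_norm (ampl_kernel k) (ampl_dom m) (mat_mult_op m F f) \<le> rkhs_norm (ampl_kernel k) (ampl_dom m) f)"

definition complete_pick :: "(complex \<Rightarrow> complex \<Rightarrow> complex) \<Rightarrow> bool" where
  "complete_pick k \<longleftrightarrow>
     (\<forall>(m::nat) (n::nat) (lam::nat \<Rightarrow> complex) (A::nat \<Rightarrow> nat \<Rightarrow> nat \<Rightarrow> complex).
        1 \<le> m \<longrightarrow> (\<forall>j<n. lam j \<in> unit_disc) \<longrightarrow>
        pos_kernel ({..<n} \<times> {..<m})
          (\<lambda>(j,a) (l,b). ((if a = b then 1 else 0) - (\<Sum>c<m. A j a c * cnj (A l b c))) * k (lam j) (lam l))
        \<longrightarrow> (\<exists>F. contractive_multiplier k m F \<and> (\<forall>j<n. \<forall>a<m. \<forall>b<m. F (lam j) a b = A j a b)))"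

definition irreducible_kernel :: "(complex \<Rightarrow> complex \<Rightarrow> complex) \<Rightarrow> bool" where
  "irreducible_kernel k \<longleftrightarrow> (\<forall>z\<in>unit_disc. \<forall>w\<in>unit_disc. k z w \<noteq> 0)"

definition extends_to_larger_disc :: "(complex \<Rightarrow> complex \<Rightarrow> complex) \<Rightarrow> bool" where
  "extends_to_larger_disc k \<longleftrightarrow>
     (\<exists>R::real. R > 1 \<and> (\<exists>K. (\<forall>z\<in>unit_disc. \<forall>w\<in>unit_disc. K z w = k z w) \<and>
        (\<forall>w\<in>ball 0 R. (\<lambda>z. K z w) holomorphic_on ball 0 R) \<and>
        (\<forall>z\<in>ball 0 R. (\<lambda>w. cnj (K z w)) holomorphic_on ball 0 R)))"

end

theory Submission
  imports Defs
begin

text \<open>Write \<open>c = 1/k(0,0)\<close>. The complete Pick property forces \<open>1 - k(0,0)/k\<close> to be a positive kernel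
  (McCullough and Quiggin), so \<open>q\<close> has Taylor coefficients \<open>b\<^sub>n \<ge> 0\<close> with \<open>b\<^sub>1 > 0\<close>, and
  \<open>\<Sum>b\<^sub>n \<le> c\<close> since \<open>1/k(x,x) > 0\<close>. Hence \<open>q\<close> has no poles on the closed disc, and \<open>c - q\<close> must vanish
  somewhere on the circle, as otherwise \<open>k = 1/(c - q)\<close> would extend. Nonnegativity and \<open>b\<^sub>1 > 0\<close>
  leave \<open>1\<close> as the only possible zero, and it is simple. The Taylor coefficients \<open>a\<^sub>n\<close> of
  \<open>1/(c - q)\<close> therefore converge to a nonzero limit, while the renewal recursion
  \<open>c a\<^sub>n = \<Sum>b\<^sub>k a\<^bsub>n-k\<^esub>\<close> makes them positive. So they lie between two positive constants, and
  \<open>k\<close> is comparable with the Szego kernel.\<close>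

section \<open>Positive kernels\<close>

text \<open>Matrices enter because the Gram vectors may grow in length with each new point. The
  construction can start because q(0) = 0 normalises the kernel, k(z,0) = k(0,0), so that the origin
  has Gram vector zero. On the analytic side the obstacle is the circle: the denominator of the
  given quotient may vanish there, so common factors are cancelled before zeros and poles are
  discussed. The zero at 1 is simple because c - q(x) \<ge> b_1 (1 - x) for 0 < x < 1. After
  division by 1 - u the remaining factor is holomorphic beyond the circle, and the a_n are the
  partial sums of its Taylor series about 0, evaluated at 1. The limit controls only the tail;
  positivity keeps the finitely many other coefficients away from 0. Bounds on coefficients become
  bounds on norms because a radial kernel with nonnegative coefficients is positive.\<close>

lemma pos_kernel_alt:
  "pos_kernel X K \<longleftrightarrow> (\<forall>(n::nat) x c. (\<forall>i<n. x i \<in> X) \<longrightarrow>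
     (\<Sum>i<n. \<Sum>j<n. c i * cnj (c j) * K (x i) (x j)) \<in> \<real>\<^sub>\<ge>\<^sub>0)"
  by (auto simp: pos_kernel_def Let_def complex_nonneg_Reals_iff)

lemma sum_in_nonneg_Reals:
  fixes f :: "_ \<Rightarrow> complex"
  assumes "\<And>i. i \<in> I \<Longrightarrow> f i \<in> \<real>\<^sub>\<ge>\<^sub>0"
  shows "sum f I \<in> \<real>\<^sub>\<ge>\<^sub>0"
  using assms by (auto simp: complex_nonneg_Reals_iff intro!: sum_nonneg sum.neutral)

lemma pos_kernelI:
  assumes "\<And>(n::nat) x c. (\<And>i. i < n \<Longrightarrow> x i \<in> X) \<Longrightarrow>
     (\<Sum>i<n. \<Sum>j<n. c i * cnj (c j) * K (x i) (x j)) \<in> \<real>\<^sub>\<ge>\<^sub>0"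
  shows "pos_kernel X K"
  using assms by (simp add: pos_kernel_alt)

text \<open>The definition numbers points by an initial segment of the naturals. Arbitrary finite
  index sets allow testing pairs of points with \<open>bool\<close>, two families at once with a
  disjoint sum, and vector-valued combinations with a product.\<close>

lemma pos_kernel_finite:
  assumes "pos_kernel X K" "finite I" "\<And>i. i \<in> I \<Longrightarrow> x i \<in> X"
  shows "(\<Sum>i\<in>I. \<Sum>j\<in>I. c i * cnj (c j) * K (x i) (x j)) \<in> \<real>\<^sub>\<ge>\<^sub>0"
proof -
  obtain h where h: "bij_betw h {..<card I} I"
    using ex_bij_betw_nat_finite[OF assms(2)] by (auto simp: atLeast0LessThan)
  have "(\<Sum>i\<in>I. \<Sum>j\<in>I. c i * cnj (c j) * K (x i) (x j))
      = (\<Sum>i<card I. \<Sum>j<card I. c (h i) * cnj (c (h j)) * K (x (h i)) (x (h j)))"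
    by (simp add: sum.reindex_bij_betw[OF h, symmetric])
  moreover have "\<forall>i<card I. x (h i) \<in> X"
    using h assms(3) by (auto simp: bij_betw_def)
  ultimately show ?thesis
    using assms(1)[unfolded pos_kernel_alt, rule_format, of "card I" "x \<circ> h" "c \<circ> h"] by simp
qed

lemma pos_kernel_cong:
  assumes "\<And>x y. x \<in> X \<Longrightarrow> y \<in> X \<Longrightarrow> K x y = L x y"
  shows "pos_kernel X K \<longleftrightarrow> pos_kernel X L"
proof -
  have "(\<Sum>i<n. \<Sum>j<n. c i * cnj (c j) * K (x i) (x j)) = (\<Sum>i<n. \<Sum>j<n. c i * cnj (c j) * L (x i) (x j))"
    if "\<forall>i<n. x i \<in> X" for n::nat and x c
    using that assms by (intro sum.cong refl) auto
  then show ?thesis by (auto simp: pos_kernel_alt)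
qed

lemma pos_kernel_add:
  assumes "pos_kernel X K" "pos_kernel X L"
  shows "pos_kernel X (\<lambda>x y. K x y + L x y)"
  using assms nonneg_Reals_add_I
  by (auto simp: pos_kernel_alt ring_distribs sum.distrib intro!: nonneg_Reals_add_I)

lemma pos_kernel_scale:
  assumes "pos_kernel X K" "(0::real) \<le> t"
  shows "pos_kernel X (\<lambda>x y. of_real t * K x y)"
proof (rule pos_kernelI)
  fix n :: nat and x c assume "\<And>i. i < n \<Longrightarrow> x i \<in> X"
  then have "(\<Sum>i<n. \<Sum>j<n. c i * cnj (c j) * K (x i) (x j)) \<in> \<real>\<^sub>\<ge>\<^sub>0"
    using assms(1) by (auto simp: pos_kernel_alt)
  moreover have "complex_of_real t \<in> \<real>\<^sub>\<ge>\<^sub>0"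
    using assms(2) by simp
  ultimately have "of_real t * (\<Sum>i<n. \<Sum>j<n. c i * cnj (c j) * K (x i) (x j)) \<in> \<real>\<^sub>\<ge>\<^sub>0"
    by (rule nonneg_Reals_mult_I[rotated])
  then show "(\<Sum>i<n. \<Sum>j<n. c i * cnj (c j) * (of_real t * K (x i) (x j))) \<in> \<real>\<^sub>\<ge>\<^sub>0"
    by (simp add: sum_distrib_left mult_ac)
qed

lemma pos_kernel_diag:
  assumes "pos_kernel X K" "x \<in> X"
  shows "K x x \<in> \<real>\<^sub>\<ge>\<^sub>0"
  using pos_kernel_finite[OF assms(1), of "{()}" "\<lambda>_. x" "\<lambda>_. 1"] assms(2) by simp

text \<open>Reality of the form is what forces symmetry. Coefficients (1, 1) cancel the imaginary
  parts of \<open>K x y + K y x\<close>; coefficients (1, i) then match the real parts.\<close>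

lemma pos_kernel_hermitian:
  assumes "pos_kernel X K" "x \<in> X" "y \<in> X"
  shows "K y x = cnj (K x y)"
proof -
  have two: "c True * cnj (c True) * K x x + c True * cnj (c False) * K x y
       + (c False * cnj (c True) * K y x + c False * cnj (c False) * K y y) \<in> \<real>\<^sub>\<ge>\<^sub>0" for c
    using pos_kernel_finite[OF assms(1), of "UNIV :: bool set" "\<lambda>b. if b then x else y" c] assms(2,3)
    by (simp add: UNIV_bool add_ac)
  have d: "K x x \<in> \<real>\<^sub>\<ge>\<^sub>0" "K y y \<in> \<real>\<^sub>\<ge>\<^sub>0"
    using pos_kernel_diag[OF assms(1)] assms(2,3) by auto
  show ?thesis
    using two[of "\<lambda>_. 1"] two[of "\<lambda>b. if b then 1 else \<i>"] d
    by (auto simp: complex_nonneg_Reals_iff complex_eq_iff)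
qed

text \<open>The sign of \<open>s\<close> has to be derived: a nonconstant linear function or a
  concave quadratic is refuted by an explicit \<open>t\<close>, and a convex one is evaluated at its
  minimum \<open>- B / s\<close>.\<close>

lemma nonneg_quadratic_imp_le:
  fixes s T B :: real
  assumes "\<And>t. 0 \<le> t\<^sup>2 * s + 2 * t * B + T"
  shows "B\<^sup>2 \<le> s * T"
proof (cases "s = 0")
  case True
  have "B = 0"
  proof (rule ccontr)
    assume "B \<noteq> 0"
    then show False using assms[of "- (T + 1) / (2 * B)"] True by (simp add: field_simps)
  qed
  with True show ?thesis by simp
next
  case False
  have "s > 0"
  proof (rule ccontr)
    assume "\<not> s > 0"
    with False have "s < 0" by simp
    define t where "t = 1 + (2 * \<bar>B\<bar> + \<bar>T\<bar>) / - s"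
    have t: "t \<ge> 1" using \<open>s < 0\<close> by (simp add: t_def divide_nonneg_neg divide_nonneg_pos del: divide_minus_right)
    have st: "s * t = s - 2 * \<bar>B\<bar> - \<bar>T\<bar>" using \<open>s < 0\<close> by (simp add: t_def field_simps)
    have "t\<^sup>2 * s + 2 * t * B + T = t * (s * t) + 2 * t * B + T"
      by (simp add: power2_eq_square mult_ac)
    also have "\<dots> = t * (s - 2 * \<bar>B\<bar> - \<bar>T\<bar>) + 2 * t * B + T"
      by (simp only: st)
    also have "\<dots> = t * s - 2 * t * (\<bar>B\<bar> - B) - (t * \<bar>T\<bar> - T)" by (simp add: algebra_simps)
    finally have eq: "t\<^sup>2 * s + 2 * t * B + T = \<dots>" .
    have "t * \<bar>T\<bar> \<ge> T" using t by (smt (verit) mult_le_cancel_right1 abs_ge_self abs_ge_zero)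
    moreover have "2 * t * (\<bar>B\<bar> - B) \<ge> 0" using t by simp
    moreover have "t * s < 0" using t \<open>s < 0\<close> by (simp add: mult_pos_neg)
    ultimately have "t\<^sup>2 * s + 2 * t * B + T < 0" unfolding eq by linarith
    with assms[of t] show False by simp
  qed
  then show ?thesis using assms[of "- B / s"]
    by (simp add: field_simps power2_eq_square)
qed

lemma unimodular_rotation:
  obtains u where "u * z = of_real (cmod z)" "u * cnj u = 1"
proof
  show "cis (- Arg z) * z = of_real (cmod z)"
    by (subst (2) rcis_cmod_Arg[of z, symmetric]) (simp add: rcis_def cis_mult mult.left_commute)
  show "cis (- Arg z) * cnj (cis (- Arg z)) = 1"
    by (simp add: cis_cnj cis_mult)
qed

text \<open>Both families are tested together on the disjoint union of their index sets. A
  unimodular factor \<open>u\<close> turns the mixed term into its modulus, so the form becomes a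
  real quadratic in \<open>t\<close> and the discriminant gives the bound.\<close>

lemma pos_kernel_Cauchy_Schwarz:
  fixes x :: "'i \<Rightarrow> 'a" and y :: "'j \<Rightarrow> 'a"
  assumes K: "pos_kernel X K" and "finite I" "finite J"
    and x: "\<And>i. i \<in> I \<Longrightarrow> x i \<in> X" and y: "\<And>j. j \<in> J \<Longrightarrow> y j \<in> X"
  shows "(cmod (\<Sum>i\<in>I. \<Sum>j\<in>J. a i * cnj (b j) * K (x i) (y j)))\<^sup>2
    \<le> Re (\<Sum>i\<in>I. \<Sum>j\<in>I. a i * cnj (a j) * K (x i) (x j))
      * Re (\<Sum>i\<in>J. \<Sum>j\<in>J. b i * cnj (b j) * K (y i) (y j))"
    (is "(cmod ?B)\<^sup>2 \<le> Re ?S * Re ?T")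
proof (rule nonneg_quadratic_imp_le)
  fix t :: real
  obtain u where uB: "u * ?B = of_real (cmod ?B)" and uu: "u * cnj u = 1"
    using unimodular_rotation by blast
  define c where "c = case_sum (\<lambda>i. of_real t * u * a i) b"
  define z where "z = case_sum x y"
  have B': "(\<Sum>j\<in>J. \<Sum>i\<in>I. b j * cnj (a i) * K (y j) (x i)) = cnj ?B"
    unfolding cnj_sum
    by (subst sum.swap) (intro sum.cong refl, simp add: pos_kernel_hermitian[OF K x y] mult_ac)
  have "(\<Sum>i\<in>I <+> J. \<Sum>j\<in>I <+> J. c i * cnj (c j) * K (z i) (z j)) \<in> \<real>\<^sub>\<ge>\<^sub>0"
    using assms by (intro pos_kernel_finite[OF K]) (auto simp: z_def)
  also have "(\<Sum>i\<in>I <+> J. \<Sum>j\<in>I <+> J. c i * cnj (c j) * K (z i) (z j))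
     = of_real (t\<^sup>2) * (u * cnj u) * ?S + of_real t * (u * ?B)
       + of_real t * cnj u * (\<Sum>j\<in>J. \<Sum>i\<in>I. b j * cnj (a i) * K (y j) (x i)) + ?T"
    using assms(2,3)
    by (simp add: sum.Plus c_def z_def sum.distrib sum_distrib_left algebra_simps power2_eq_square)
  also have "\<dots> = of_real (t\<^sup>2) * ?S + of_real t * (u * ?B) + of_real t * cnj (u * ?B) + ?T"
    unfolding B' uu complex_cnj_mult by (simp only: mult_1_right mult.assoc)
  also have "\<dots> = of_real (t\<^sup>2) * ?S + 2 * of_real t * of_real (cmod ?B) + ?T"
    by (simp add: uB)
  finally show "0 \<le> t\<^sup>2 * Re ?S + 2 * t * cmod ?B + Re ?T"
    by (simp add: complex_nonneg_Reals_iff del: of_real_power)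
qed

section \<open>Multipliers and the complete Pick property\<close>

text \<open>Sorting the coefficients by second coordinate splits the form into one form per block.
  The blocks may differ: amplification uses copies of \<open>k\<close>, while the Pick condition
  below has one constant block.\<close>

lemma pos_kernel_block_diagonal:
  fixes M :: "nat \<Rightarrow> 'a \<Rightarrow> 'a \<Rightarrow> complex"
  assumes "\<And>a. a < m \<Longrightarrow> pos_kernel X (M a)"
  shows "pos_kernel (X \<times> {..<m}) (\<lambda>(z, a) (w, b). if a = b then M a z w else 0)"
    (is "pos_kernel _ ?K")
proof (rule pos_kernelI)
  fix n :: nat and x :: "nat \<Rightarrow> 'a \<times> nat" and c :: "nat \<Rightarrow> complex"
  assume x: "\<And>i. i < n \<Longrightarrow> x i \<in> X \<times> {..<m}"
  define e where "e a i = (if snd (x i) = a then c i else 0)" for a i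
  have dom: "fst (x i) \<in> X" "snd (x i) < m" if "i < n" for i
    using x[OF that] by auto
  have "(\<Sum>a<m. e a i * cnj (e a j) * M a (fst (x i)) (fst (x j)))
      = c i * cnj (c j) * ?K (x i) (x j)" if "i < n" "j < n" for i j
  proof -
    have "(\<Sum>a<m. e a i * cnj (e a j) * M a (fst (x i)) (fst (x j)))
        = (\<Sum>a<m. if a = snd (x i) then c i * cnj (c j) * ?K (x i) (x j) else 0)"
      by (intro sum.cong refl) (auto simp: e_def split: prod.splits)
    then show ?thesis using dom(2)[OF that(1)] by simp
  qed
  then have "(\<Sum>i<n. \<Sum>j<n. c i * cnj (c j) * ?K (x i) (x j))
    = (\<Sum>i<n. \<Sum>j<n. \<Sum>a<m. e a i * cnj (e a j) * M a (fst (x i)) (fst (x j)))"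
    by (intro sum.cong refl) auto
  also have "\<dots> = (\<Sum>a<m. \<Sum>i<n. \<Sum>j<n. e a i * cnj (e a j) * M a (fst (x i)) (fst (x j)))"
    by (subst (2) sum.swap, subst sum.swap, rule refl)
  also have "\<dots> \<in> \<real>\<^sub>\<ge>\<^sub>0"
  proof (rule sum_in_nonneg_Reals)
    fix a assume "a \<in> {..<m}"
    then show "(\<Sum>i<n. \<Sum>j<n. e a i * cnj (e a j) * M a (fst (x i)) (fst (x j))) \<in> \<real>\<^sub>\<ge>\<^sub>0"
      using dom(1) by (intro pos_kernel_finite[OF assms]) auto
  qed
  finally show "(\<Sum>i<n. \<Sum>j<n. c i * cnj (c j) * ?K (x i) (x j)) \<in> \<real>\<^sub>\<ge>\<^sub>0" .
qed

lemma pos_kernel_ampl: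
  assumes "pos_kernel unit_disc k"
  shows "pos_kernel (ampl_dom m) (ampl_kernel k)"
  using pos_kernel_block_diagonal[of m unit_disc "\<lambda>_. k"] assms
  by (simp add: ampl_dom_def ampl_kernel_def)

text \<open>\<open>s\<close> is the squared Hilbert norm of the kernel combination. Since the space
  is defined by domination, membership amounts to Cauchy-Schwarz between the test points and the
  nodes \<open>\<xi>\<close>.\<close>

lemma kernel_combination_in_rkhs:
  fixes \<xi> :: "'i \<Rightarrow> 'a" and c :: "'i \<Rightarrow> complex"
  assumes K: "pos_kernel X K" and "finite I" and \<xi>: "\<And>i. i \<in> I \<Longrightarrow> \<xi> i \<in> X"
  defines "f \<equiv> (\<lambda>y. if y \<in> X then \<Sum>i\<in>I. cnj (c i) * K y (\<xi> i) else 0)"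
    and "s \<equiv> Re (\<Sum>i\<in>I. \<Sum>j\<in>I. c i * cnj (c j) * K (\<xi> i) (\<xi> j))"
  shows "f \<in> rkhs K X" "rkhs_norm K X f \<le> sqrt s" "0 \<le> s"
proof -
  show s0: "0 \<le> s"
    using pos_kernel_finite[OF K \<open>finite I\<close> \<xi>, where c = c] by (simp add: s_def complex_nonneg_Reals_iff)
  have pk: "pos_kernel X (\<lambda>x y. of_real s * K x y - f x * cnj (f y))"
  proof (rule pos_kernelI)
    fix n :: nat and x b assume x: "\<And>i. i < n \<Longrightarrow> x i \<in> X"
    define T where "T = (\<Sum>i<n. \<Sum>j<n. b i * cnj (b j) * K (x i) (x j))"
    define B where "B = (\<Sum>i<n. \<Sum>j\<in>I. b i * cnj (c j) * K (x i) (\<xi> j))"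
    have T: "T \<in> \<real>\<^sub>\<ge>\<^sub>0" using x unfolding T_def by (intro pos_kernel_finite[OF K]) auto
    have B: "B = (\<Sum>i<n. b i * f (x i))"
      using x by (simp add: B_def f_def sum_distrib_left mult_ac)
    have "(cmod B)\<^sup>2 \<le> Re T * s"
      unfolding B_def T_def s_def
      using x \<xi> \<open>finite I\<close> by (intro pos_kernel_Cauchy_Schwarz[OF K]) auto
    moreover have "(\<Sum>i<n. \<Sum>j<n. b i * cnj (b j) * (of_real s * K (x i) (x j) - f (x i) * cnj (f (x j))))
      = of_real s * T - B * cnj B"
    proof -
      have "B * cnj B = (\<Sum>i<n. \<Sum>j<n. b i * cnj (b j) * (f (x i) * cnj (f (x j))))"
        by (simp add: B sum_product mult_ac)
      then show ?thesis by (simp add: T_def sum_distrib_left right_diff_distrib sum_subtractf mult_ac)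
    qed
    moreover have "B * cnj B = of_real ((cmod B)\<^sup>2)"
      by (rule complex_norm_square[symmetric])
    ultimately show "(\<Sum>i<n. \<Sum>j<n. b i * cnj (b j) *
        (of_real s * K (x i) (x j) - f (x i) * cnj (f (x j)))) \<in> \<real>\<^sub>\<ge>\<^sub>0"
      using T by (simp add: complex_nonneg_Reals_iff mult.commute del: of_real_power)
  qed
  show "f \<in> rkhs K X"
    using s0 pk by (auto simp: rkhs_def f_def)
  show "rkhs_norm K X f \<le> sqrt s"
    unfolding rkhs_norm_def
    using s0 pk by (intro cInf_lower bdd_belowI[of _ 0]) auto
qed

text \<open>With \<open>h\<close> the combination of kernel functions given by \<open>\<alpha>\<close>, the argument is
  \<open>\<parallel>M\<^sup>*h\<parallel>\<^sup>2 = \<langle>MM\<^sup>*h, h\<rangle> \<le> \<parallel>MM\<^sup>*h\<parallel> \<parallel>h\<parallel> \<le> \<parallel>M\<^sup>*h\<parallel> \<parallel>h\<parallel>\<close>;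
  in the proof \<open>f = M\<^sup>*h\<close>, \<open>g = MM\<^sup>*h\<close>, \<open>S = \<parallel>M\<^sup>*h\<parallel>\<^sup>2\<close> and \<open>P = \<parallel>h\<parallel>\<^sup>2\<close>.\<close>

lemma contractive_multiplier_row_bound:
  fixes n :: nat
  assumes k: "pos_kernel unit_disc k" and F: "contractive_multiplier k m F" and "0 < m"
    and x: "\<And>i. i < n \<Longrightarrow> x i \<in> unit_disc"
  shows "(\<Sum>i<n. \<Sum>j<n. \<alpha> i * cnj (\<alpha> j) *
     ((1 - (\<Sum>b<m. F (x i) 0 b * cnj (F (x j) 0 b))) * k (x i) (x j))) \<in> \<real>\<^sub>\<ge>\<^sub>0"
proof -
  define K where "K = ampl_kernel k"
  define X where "X = ampl_dom m"
  have K: "pos_kernel X K" using pos_kernel_ampl[OF k] by (simp add: K_def X_def)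
  define I where "I = {..<n} \<times> {..<m}"
  define \<xi> where "\<xi> = (\<lambda>(i, b::nat). (x i, b))"
  \<comment> \<open>The adjoint sends the kernel function at \<open>(x i, 0)\<close> to a
    combination over the points \<open>(x i, b)\<close> with the conjugated weights
    \<open>F (x i) 0 b\<close>; the definition of \<open>f\<close> supplies the conjugation.\<close>
  define c where "c = (\<lambda>(i, b). \<alpha> i * F (x i) 0 b)"
  define f where "f = (\<lambda>y. if y \<in> X then \<Sum>i\<in>I. cnj (c i) * K y (\<xi> i) else 0)"
  define S where "S = (\<Sum>i\<in>I. \<Sum>j\<in>I. c i * cnj (c j) * K (\<xi> i) (\<xi> j))"
  define P where "P = (\<Sum>i<n. \<Sum>j<n. \<alpha> i * cnj (\<alpha> j) * k (x i) (x j))"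
  have \<xi>: "\<xi> i \<in> X" if "i \<in> I" for i
    using that x by (auto simp: \<xi>_def X_def ampl_dom_def I_def)
  have fin: "finite I" by (simp add: I_def)
  have S: "S \<in> \<real>\<^sub>\<ge>\<^sub>0" unfolding S_def using \<xi> fin by (intro pos_kernel_finite[OF K]) auto
  have P: "P \<in> \<real>\<^sub>\<ge>\<^sub>0" unfolding P_def using x by (intro pos_kernel_finite[OF k]) auto
  have comb: "f \<in> rkhs K X" "rkhs_norm K X f \<le> sqrt (Re S)" "0 \<le> Re S"
    unfolding f_def S_def using \<xi> fin by (intro kernel_combination_in_rkhs[OF K]; simp)+
  define g where "g = mat_mult_op m F f"
  have g: "g \<in> rkhs K X" "rkhs_norm K X g \<le> sqrt (Re S)"
    using F comb(1,2) order_trans unfolding contractive_multiplier_def g_def K_def X_def by blast+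
  have "(\<Sum>i<n. \<alpha> i * g (x i, 0)) = (\<Sum>i<n. \<Sum>b<m. \<alpha> i * F (x i) 0 b * f (x i, b))"
    using \<open>0 < m\<close> x by (intro sum.cong refl) (auto simp: g_def mat_mult_op_def sum_distrib_left mult_ac)
  also have "\<dots> = (\<Sum>i\<in>I. c i * f (\<xi> i))"
    unfolding I_def sum.cartesian_product[symmetric]
    by (simp add: sum.cartesian_product c_def \<xi>_def case_prod_beta)
  also have "\<dots> = S"
    unfolding S_def using \<xi> by (intro sum.cong refl) (simp add: f_def sum_distrib_left mult_ac)
  finally have gS: "(\<Sum>i<n. \<alpha> i * g (x i, 0)) = S" .
  \<comment> \<open>The norm of \<open>g\<close> is defined as an infimum, which yields an
    admissible constant only up to a slack \<open>\<delta>\<close>; the slack tends to 0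
    below.\<close>
  have le: "(Re S)\<^sup>2 \<le> (sqrt (Re S) + \<delta>)\<^sup>2 * Re P" if "\<delta> > 0" for \<delta>
  proof -
    define A where "A = {sqrt t | t. t \<ge> 0 \<and> pos_kernel X (\<lambda>x y. of_real t * K x y - g x * cnj (g y))}"
    have "A \<noteq> {}" using g(1) by (auto simp: A_def rkhs_def)
    moreover have "Inf A < sqrt (Re S) + \<delta>" using g(2) that by (simp add: rkhs_norm_def A_def)
    ultimately obtain a where "a \<in> A" "a < sqrt (Re S) + \<delta>" using cInf_lessD by blast
    then obtain t where t: "t \<ge> 0" "pos_kernel X (\<lambda>x y. of_real t * K x y - g x * cnj (g y))"
      "sqrt t < sqrt (Re S) + \<delta>" by (auto simp: A_def)
    have "(\<Sum>i<n. \<Sum>j<n. \<alpha> i * cnj (\<alpha> j) * (of_real t * K (x i,0) (x j,0) - g (x i,0) * cnj (g (x j,0)))) \<in> \<real>\<^sub>\<ge>\<^sub>0"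
      using x \<open>0 < m\<close> by (intro pos_kernel_finite[OF t(2)]) (auto simp: X_def ampl_dom_def)
    also have "(\<Sum>i<n. \<Sum>j<n. \<alpha> i * cnj (\<alpha> j) * (of_real t * K (x i,0) (x j,0) - g (x i,0) * cnj (g (x j,0))))
      = of_real t * P - S * cnj S"
    proof -
      have "S * cnj S = (\<Sum>i<n. \<Sum>j<n. \<alpha> i * cnj (\<alpha> j) * (g (x i,0) * cnj (g (x j,0))))"
        by (simp add: gS[symmetric] sum_product mult_ac)
      then show ?thesis
        by (simp add: P_def K_def ampl_kernel_def sum_distrib_left right_diff_distrib sum_subtractf mult_ac)
    qed
    finally have "(Re S)\<^sup>2 \<le> t * Re P"
      using S P by (simp add: complex_nonneg_Reals_iff power2_eq_square)
    also have "t \<le> (sqrt (Re S) + \<delta>)\<^sup>2"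
      using t(1,3) by (metis less_imp_le power_mono real_sqrt_ge_0_iff real_sqrt_pow2)
    finally show ?thesis using P by (simp add: complex_nonneg_Reals_iff mult_right_mono)
  qed
  have "((\<lambda>\<delta>. (sqrt (Re S) + \<delta>)\<^sup>2 * Re P) \<longlongrightarrow> (sqrt (Re S) + 0)\<^sup>2 * Re P) (at_right 0)"
    by (intro tendsto_intros)
  moreover have "eventually (\<lambda>\<delta>. (Re S)\<^sup>2 \<le> (sqrt (Re S) + \<delta>)\<^sup>2 * Re P) (at_right 0)"
    using le by (auto simp: eventually_at_right_less eventually_at_filter)
  ultimately have "(Re S)\<^sup>2 \<le> (sqrt (Re S) + 0)\<^sup>2 * Re P"
    by (rule tendsto_lowerbound) auto
  then have "(Re S)\<^sup>2 \<le> Re S * Re P" using comb(3) by simp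
  then have SP: "Re S \<le> Re P"
    using S P by (cases "Re S = 0") (auto simp: complex_nonneg_Reals_iff power2_eq_square)
  have "S = (\<Sum>i<n. \<Sum>b<m. \<Sum>j<n. \<alpha> i * cnj (\<alpha> j) * (F (x i) 0 b * cnj (F (x j) 0 b)) * k (x i) (x j))"
  proof -
    have "S = (\<Sum>i<n. \<Sum>b<m. \<Sum>j<n. \<Sum>d<m. (if d = b then \<alpha> i * cnj (\<alpha> j) * (F (x i) 0 b * cnj (F (x j) 0 b)) * k (x i) (x j) else 0))"
      unfolding S_def I_def sum.cartesian_product'
      by (intro sum.cong refl) (auto simp: c_def \<xi>_def K_def ampl_kernel_def mult_ac)
    then show ?thesis by simp
  qed
  also have "\<dots> = (\<Sum>i<n. \<Sum>j<n. \<alpha> i * cnj (\<alpha> j) * (\<Sum>b<m. F (x i) 0 b * cnj (F (x j) 0 b)) * k (x i) (x j))"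
    by (rule sum.cong[OF refl], subst sum.swap) (simp add: sum_distrib_left sum_distrib_right mult_ac)
  finally have "(\<Sum>i<n. \<Sum>j<n. \<alpha> i * cnj (\<alpha> j) *
     ((1 - (\<Sum>b<m. F (x i) 0 b * cnj (F (x j) 0 b))) * k (x i) (x j))) = P - S"
    by (simp add: P_def algebra_simps sum_subtractf)
  then show ?thesis using S P SP by (simp add: complex_nonneg_Reals_iff)
qed

section \<open>Gram vectors from matrix interpolation\<close>

lemma gram_form_nonneg:
  fixes c :: "nat \<Rightarrow> complex" and m n :: nat
  assumes "\<And>i j. i < n \<Longrightarrow> j < n \<Longrightarrow> G i j = (\<Sum>q<m. a i q * cnj (a j q))"
  shows "(\<Sum>i<n. \<Sum>j<n. c i * cnj (c j) * G i j) \<in> \<real>\<^sub>\<ge>\<^sub>0"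
proof -
  have "(\<Sum>i<n. \<Sum>j<n. c i * cnj (c j) * G i j)
     = (\<Sum>i<n. \<Sum>j<n. \<Sum>q<m. (c i * a i q) * cnj (c j * a j q))"
    using assms by (intro sum.cong refl) (simp add: sum_distrib_left mult_ac)
  also have "\<dots> = (\<Sum>q<m. \<Sum>i<n. \<Sum>j<n. (c i * a i q) * cnj (c j * a j q))"
    by (subst (2) sum.swap, subst sum.swap, rule refl)
  also have "\<dots> = (\<Sum>q<m. (\<Sum>i<n. c i * a i q) * cnj (\<Sum>i<n. c i * a i q))"
    by (simp add: sum_product)
  also have "\<dots> \<in> \<real>\<^sub>\<ge>\<^sub>0"
    by (intro sum_in_nonneg_Reals) (simp add: complex_norm_square[symmetric] del: of_real_power cnj_sum)
  finally show ?thesis .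
qed

lemma pos_kernel_const:
  assumes "t \<in> \<real>\<^sub>\<ge>\<^sub>0"
  shows "pos_kernel X (\<lambda>_ _. t)"
proof (rule pos_kernelI)
  fix n :: nat and c :: "nat \<Rightarrow> complex"
  have "(\<Sum>i<n. c i) * cnj (\<Sum>i<n. c i) = (\<Sum>i<n. \<Sum>j<n. c i * cnj (c j))"
    by (simp add: sum_product)
  then have "(\<Sum>i<n. \<Sum>j<n. c i * cnj (c j) * t) = t * ((\<Sum>i<n. c i) * cnj (\<Sum>i<n. c i))"
    by (simp add: sum_distrib_left mult.commute)
  also have "\<dots> \<in> \<real>\<^sub>\<ge>\<^sub>0"
    by (rule nonneg_Reals_mult_I[OF assms])
       (simp add: complex_norm_square[symmetric] del: of_real_power cnj_sum)
  finally show "(\<Sum>i<n. \<Sum>j<n. c i * cnj (c j) * t) \<in> \<real>\<^sub>\<ge>\<^sub>0" .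
qed

lemma pos_kernel_compose:
  assumes "pos_kernel X K" "\<And>y. y \<in> Y \<Longrightarrow> g y \<in> X"
  shows "pos_kernel Y (\<lambda>x y. K (g x) (g y))"
  using assms(2) by (intro pos_kernelI pos_kernel_finite[OF assms(1)]) auto

lemma pos_kernel_contractive_row:
  assumes "pos_kernel unit_disc k" "contractive_multiplier k m F" "0 < m"
  shows "pos_kernel unit_disc (\<lambda>z w. (1 - (\<Sum>b<m. F z 0 b * cnj (F w 0 b))) * k z w)"
  by (intro pos_kernelI contractive_multiplier_row_bound[OF assms])

text \<open>The difference of the evaluations at \<open>u\<close> and \<open>v\<close> has squared
  length t - t - t + t = 0, so Cauchy-Schwarz makes it orthogonal to the evaluation at
  \<open>w\<close>.\<close>

lemma pos_kernel_degenerate_pair: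
  assumes R: "pos_kernel X R" and "u \<in> X" "v \<in> X" "w \<in> X"
    and "R u u = t" "R u v = t" "R v u = t" "R v v = t"
  shows "R u w = R v w"
proof -
  have "(cmod (\<Sum>i\<in>(UNIV::bool set). \<Sum>j\<in>(UNIV::unit set). (if i then 1 else -1) * cnj 1 * R (if i then u else v) w))\<^sup>2
    \<le> Re (\<Sum>i\<in>(UNIV::bool set). \<Sum>j\<in>(UNIV::bool set). (if i then 1 else -1) * cnj (if j then 1 else -1) * R (if i then u else v) (if j then u else v))
      * Re (\<Sum>i\<in>(UNIV::unit set). \<Sum>j\<in>(UNIV::unit set). 1 * cnj 1 * R w w)"
    using assms(2-4) by (intro pos_kernel_Cauchy_Schwarz[OF R]) auto
  then show ?thesis
    using assms(5-) by (simp add: UNIV_bool UNIV_unit)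
qed

text \<open>Gram vectors of \<open>1 - k(0,0)/k\<close> are found one point at a time. If \<open>a\<^sub>i\<close> are Gram vectors for
  the first \<open>n\<close> points, the matrices with first row \<open>a\<^sub>i\<close> and all other rows zero satisfy the Pick
  condition, because \<open>(1 - \<langle>a\<^sub>i, a\<^sub>j\<rangle>) k(x\<^sub>i, x\<^sub>j)\<close> is constant. The first row \<open>d\<close> of the interpolating
  multiplier at the new point then has the right inner products with all \<open>a\<^sub>i\<close>, and its norm is
  at most the required one; the deficit goes into an additional coordinate.\<close>

lemma complete_pick_gram:
  fixes x :: "nat \<Rightarrow> complex"
  assumes k: "pos_kernel unit_disc k" and irr: "irreducible_kernel k" and pick: "complete_pick k"
    and k0: "\<And>z. z \<in> unit_disc \<Longrightarrow> k z 0 = k 0 0"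
    and x0: "x 0 = 0"
  shows "(\<forall>i<n. x i \<in> unit_disc) \<Longrightarrow>
    \<exists>(m::nat) a. 0 < m \<and> (\<forall>i<n. \<forall>j<n. 1 - k 0 0 / k (x i) (x j) = (\<Sum>q<m. a i q * cnj (a j q)))"
proof (induction n)
  case 0
  show ?case by (intro exI[of _ "1::nat"] exI[of _ "\<lambda>_ _. 0"]) simp
next
  case (Suc n)
  define Q where "Q z w = 1 - k 0 0 / k z w" for z w
  have nz: "k z w \<noteq> 0" if "z \<in> unit_disc" "w \<in> unit_disc" for z w
    using irr that by (auto simp: irreducible_kernel_def)
  have k00: "k 0 0 \<in> \<real>\<^sub>\<ge>\<^sub>0" "k 0 0 \<noteq> 0"
    using pos_kernel_diag[OF k] nz[of 0 0] by auto
  show ?case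
  proof (cases "n = 0")
    case True
    show ?thesis
      by (intro exI[of _ "1::nat"] exI[of _ "\<lambda>_ _. 0"]) (use True x0 k00 in auto)
  next
    case False
    have "\<forall>i<n. x i \<in> unit_disc" using Suc.prems by simp
    from Suc.IH[OF this] obtain m :: nat and a where m: "0 < m"
      and a': "\<forall>i<n. \<forall>j<n. 1 - k 0 0 / k (x i) (x j) = (\<Sum>q<m. a i q * cnj (a j q))"
      by blast
    have a: "Q (x i) (x j) = (\<Sum>q<m. a i q * cnj (a j q))" if "i < n" "j < n" for i j
      using a' that by (simp add: Q_def)
    have x: "x i \<in> unit_disc" if "i \<le> n" for i using Suc.prems that by simp
    have kQ: "(1 - Q (x i) (x j)) * k (x i) (x j) = k 0 0" if "i \<le> n" "j \<le> n" for i j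
      using nz[OF x x] that by (simp add: Q_def)
    \<comment> \<open>The Gram vector at the origin has squared length 1 - k(0,0)/k(0,0) =
      0.\<close>
    have a0: "a 0 q = 0" if "q < m" for q
    proof -
      have "(\<Sum>q<m. of_real ((cmod (a 0 q))\<^sup>2)) = (0::complex)"
        using a[of 0 0] False x0 k00(2) by (simp add: Q_def complex_norm_square del: of_real_power)
      then have "(\<Sum>q<m. (cmod (a 0 q))\<^sup>2) = 0"
        unfolding of_real_sum[symmetric] of_real_eq_0_iff .
      then show ?thesis using that by (simp add: sum_nonneg_eq_0_iff)
    qed
    have ka: "k 0 0 = (1 - (\<Sum>q<m. a i q * cnj (a j q))) * k (x i) (x j)" if "i < n" "j < n" for i j
      using kQ[of i j] a[of i j] that by simp
    define A where "A j p q = (if p = 0 then a j q else 0)" for j p q :: nat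
    \<comment> \<open>Row 0 of the Pick matrix contributes the constant k(0,0); the zero rows leave
      the kernel itself.\<close>
    define M where "M = (\<lambda>p. if p = (0::nat) then (\<lambda>_ _. k 0 0) else (\<lambda>i j. k (x i) (x j)))"
    have "pos_kernel ({..<n} \<times> {..<m}) (\<lambda>(i, p) (j, q). if p = q then M p i j else 0)"
      using x k00(1) by (intro pos_kernel_block_diagonal)
        (auto simp: M_def intro!: pos_kernel_const pos_kernel_compose[OF k])
    also have "?this \<longleftrightarrow> pos_kernel ({..<n} \<times> {..<m})
          (\<lambda>(j,p) (l,q). ((if p = q then 1 else 0) - (\<Sum>c<m. A j p c * cnj (A l q c))) * k (x j) (x l))"
      using ka[symmetric] m by (intro pos_kernel_cong) (auto simp: A_def M_def)
    finally have "\<exists>F. contractive_multiplier k m F \<and> (\<forall>j<n. \<forall>p<m. \<forall>q<m. F (x j) p q = A j p q)"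
      using m x by (intro pick[unfolded complete_pick_def, rule_format]) auto
    then obtain F where F: "contractive_multiplier k m F"
      "\<And>j p q. j < n \<Longrightarrow> p < m \<Longrightarrow> q < m \<Longrightarrow> F (x j) p q = A j p q"
      by blast
    define R where "R = (\<lambda>z w. (1 - (\<Sum>b<m. F z 0 b * cnj (F w 0 b))) * k z w)"
    have R: "pos_kernel unit_disc R"
      unfolding R_def by (rule pos_kernel_contractive_row[OF k F(1) m])
    have Fx: "F (x j) 0 q = a j q" if "j < n" "q < m" for j q
      using F(2)[OF that(1) m that(2)] by (simp add: A_def)
    have Rx: "R (x i) (x j) = k 0 0" if "i < n" "j < n" for i j
      using kQ[of i j] a[of i j] that by (simp add: R_def Fx)
    define y where "y = x n"
    define d where "d q = F y 0 q" for q
    have y: "y \<in> unit_disc" using x by (simp add: y_def)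
    \<comment> \<open>Row 0 of \<open>F\<close> vanishes at the origin, so there \<open>R\<close>
      reduces to the normalised kernel.\<close>
    have R0y: "R (x 0) y = k 0 0"
    proof -
      have "F 0 0 q = 0" if "q < m" for q
        using Fx[of 0 q] a0 False x0 that by simp
      then have "R (x 0) y = k 0 y" by (simp add: R_def x0)
      also have "\<dots> = cnj (k y 0)" using y by (intro pos_kernel_hermitian[OF k]) auto
      also have "\<dots> = k 0 0" using k0[OF y] k00 by (auto simp: complex_nonneg_Reals_iff complex_eq_iff)
      finally show ?thesis .
    qed
    \<comment> \<open>\<open>R\<close> is constantly k(0,0) on the old points, so they are
      indistinguishable to it and the value at the origin passes to every
      \<open>x i\<close>.\<close>
    have Rxy: "R (x i) y = k 0 0" if "i < n" for i
      using pos_kernel_degenerate_pair[OF R x x y, of i 0 "k 0 0"] Rx R0y that by simp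
    have axy: "(\<Sum>q<m. a i q * cnj (d q)) = Q (x i) y" if "i < n" for i
      using Rxy[OF that] nz[OF x y, of i] that by (simp add: R_def Fx d_def Q_def field_simps)
    have ck: "cnj (k 0 0) = k 0 0" using k00(1) by (simp add: complex_nonneg_Reals_iff complex_eq_iff)
    have herm: "Q w z = cnj (Q z w)" if "z \<in> unit_disc" "w \<in> unit_disc" for z w
      using pos_kernel_hermitian[OF k that] by (simp add: Q_def ck)
    have Qyy: "Q y y \<in> \<real>" using herm[OF y y] by (metis Reals_cnj_iff)
    define D where "D = (\<Sum>q<m. (cmod (d q))\<^sup>2)"
    have D: "complex_of_real D = (\<Sum>q<m. d q * cnj (d q))"
      by (simp add: D_def complex_norm_square del: of_real_power)
    have kyy: "k y y \<in> \<real>\<^sub>\<ge>\<^sub>0" "k y y \<noteq> 0" using pos_kernel_diag[OF k y] nz[OF y y] by auto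
    \<comment> \<open>The form of \<open>R\<close> at the origin and \<open>y\<close> with
      coefficients -1 and 1 collapses to this difference; its sign bounds the length of
      \<open>d\<close>.\<close>
    have "R y y - k 0 0 \<in> \<real>\<^sub>\<ge>\<^sub>0"
    proof -
      have "R y (x 0) = k 0 0"
        using pos_kernel_hermitian[OF R x y, of 0] R0y by (simp add: ck)
      then show ?thesis
        using pos_kernel_finite[OF R, of UNIV "\<lambda>b. if b then x 0 else y" "\<lambda>b. if b then -1 else 1"]
          x[of 0] y Rx[of 0 0] R0y False by (simp add: UNIV_bool)
    qed
    also have "R y y - k 0 0 = of_real (Re (k y y) * (Re (Q y y) - D))"
    proof -
      have "R y y - k 0 0 = (Q y y - D) * k y y"
        using kyy(2) by (simp add: R_def D d_def Q_def field_simps)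
      moreover have "Q y y = of_real (Re (Q y y))" "k y y = of_real (Re (k y y))"
        using Qyy kyy(1) by (auto simp: complex_nonneg_Reals_iff complex_eq_iff complex_is_Real_iff)
      ultimately show ?thesis by (metis mult.commute of_real_diff of_real_mult)
    qed
    finally have "0 \<le> Re (k y y) * (Re (Q y y) - D)" by (simp only: nonneg_Reals_of_real_iff)
    moreover have "Re (k y y) > 0" using kyy by (auto simp: complex_nonneg_Reals_iff complex_eq_iff less_le)
    ultimately have DQ: "D \<le> Re (Q y y)" by (simp add: zero_le_mult_iff)
    define e where "e = sqrt (Re (Q y y) - D)"
    have ee: "complex_of_real e * of_real e = Q y y - D"
      using DQ Qyy by (simp add: e_def of_real_mult[symmetric] del: of_real_mult)
    define b where "b i q = (if i = n then (if q = m then of_real e else d q) else (if q = m then 0 else a i q))" for i q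
    have "Q (x i) (x j) = (\<Sum>q<Suc m. b i q * cnj (b j q))"
      if ij: "i < Suc n" "j < Suc n" for i j
    proof -
      consider "i < n" "j < n" | "i < n" "j = n" | "i = n" "j < n" | "i = n" "j = n"
        using ij less_Suc_eq by blast
      then show ?thesis
      proof cases
        case 1
        then show ?thesis by (simp add: b_def a)
      next
        case 2
        then show ?thesis by (simp add: b_def axy y_def)
      next
        case 3
        have "Q y (x j) = cnj (Q (x j) y)" using herm[OF x y, of j] 3 by simp
        also have "\<dots> = (\<Sum>q<m. d q * cnj (a j q))" using 3 by (simp add: axy[symmetric] mult.commute)
        finally show ?thesis using 3 by (simp add: b_def y_def)
      next
        case 4
        then show ?thesis by (simp add: b_def ee D[symmetric] y_def[symmetric])
      qed
    qed
    then show ?thesis unfolding Q_def by blast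
  qed
qed

lemma complete_pick_pos_kernel:
  assumes "pos_kernel unit_disc k" "irreducible_kernel k" "complete_pick k"
    and "\<And>z. z \<in> unit_disc \<Longrightarrow> k z 0 = k 0 0"
  shows "pos_kernel unit_disc (\<lambda>z w. 1 - k 0 0 / k z w)"
proof (rule pos_kernelI)
  fix n :: nat and x c assume x: "\<And>i. i < n \<Longrightarrow> x i \<in> unit_disc"
  \<comment> \<open>The Gram construction starts at the origin, so 0 is put in front of the points
    and dropped again by the shift to \<open>Suc i\<close>.\<close>
  define y where "y = case_nat 0 x"
  have y: "\<forall>i<Suc n. y i \<in> unit_disc"
  proof (intro allI impI)
    fix i assume "i < Suc n"
    then show "y i \<in> unit_disc" using x by (cases i) (simp_all add: y_def)
  qed
  have "y 0 = 0" by (simp add: y_def)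
  from complete_pick_gram[OF assms this y]
  obtain m :: nat and a where a: "\<forall>i<Suc n. \<forall>j<Suc n.
      1 - k 0 0 / k (y i) (y j) = (\<Sum>q<m. a i q * cnj (a j q))"
    by metis
  show "(\<Sum>i<n. \<Sum>j<n. c i * cnj (c j) * (1 - k 0 0 / k (x i) (x j))) \<in> \<real>\<^sub>\<ge>\<^sub>0"
  proof (rule gram_form_nonneg[where a = "\<lambda>i. a (Suc i)" and m = m])
    fix i j assume "i < n" "j < n"
    then show "1 - k 0 0 / k (x i) (x j) = (\<Sum>q<m. a (Suc i) q * cnj (a (Suc j) q))"
      using a[rule_format, of "Suc i" "Suc j"] by (simp add: y_def)
  qed
qed

section \<open>Positive kernels and Taylor coefficients\<close>

text \<open>Discrete orthogonality: once M exceeds l and n, the ratio is an M-th root of unity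
  different from 1 when l \<noteq> n, so its geometric sum vanishes. The uniform bound prepares
  dominated convergence.\<close>

lemma root_of_unity_mean_tendsto:
  fixes l n :: nat
  defines "z \<equiv> (\<lambda>M. exp (2 * of_real pi * \<i> * of_nat l / of_nat M) / exp (2 * of_real pi * \<i> * of_nat n / of_nat M) :: complex)"
  shows "(\<lambda>M. (\<Sum>j<M. z M ^ j) / of_nat M) \<longlonglongrightarrow> (if l = n then 1 else 0)"
    and "cmod ((\<Sum>j<M. z M ^ j) / of_nat M) \<le> 1"
proof -
  have nz: "cmod (z M) = 1" for M
    by (simp add: z_def norm_divide exp_eq_polar norm_mult)
  have "cmod (\<Sum>j<M. z M ^ j) \<le> of_nat M"
    using sum_norm_le[of "{..<M}" "\<lambda>j. z M ^ j" "\<lambda>_. 1"] by (simp add: norm_power nz)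
  then show "cmod ((\<Sum>j<M. z M ^ j) / of_nat M) \<le> 1"
    by (cases "M = 0") (simp_all add: norm_divide)
  have "eventually (\<lambda>M. (\<Sum>j<M. z M ^ j) / of_nat M = (if l = n then 1 else 0)) sequentially"
    using eventually_gt_at_top[of "max l n"]
  proof eventually_elim
    case (elim M)
    then have M: "l < M" "n < M" "1 \<le> M" by auto
    show ?case
    proof (cases "l = n")
      case True
      then show ?thesis using M by (simp add: z_def)
    next
      case False
      have "z M \<noteq> 1"
        using complex_root_unity_eq[OF M(3), of l n] False M by (simp add: z_def cong_def)
      moreover have "z M ^ M = 1"
        using complex_root_unity[of M l] complex_root_unity[of M n] M
        by (simp add: z_def power_divide)
      ultimately have "(\<Sum>j<M. z M ^ j) = 0" by (simp add: geometric_sum)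
      then show ?thesis using False by simp
    qed
  qed
  then show "(\<lambda>M. (\<Sum>j<M. z M ^ j) / of_nat M) \<longlonglongrightarrow> (if l = n then 1 else 0)"
    by (rule tendsto_eventually)
qed

text \<open>The functionals are discrete Fourier transforms on the circle of radius \<open>\<rho>\<close>. They extract
  Taylor coefficients from finite combinations of point evaluations, which are all that
  \<open>pos_kernel\<close> gives access to.\<close>

lemma exists_moment_functionals:
  fixes d :: "nat \<Rightarrow> complex" and N :: nat
  assumes \<rho>: "0 < \<rho>" "\<rho> < 1"
  obtains x c :: "nat \<Rightarrow> nat \<Rightarrow> complex" and C :: real
  where "\<And>M j. x M j \<in> unit_disc"
    and "\<And>M l. cmod (\<Sum>j<M. c M j * x M j ^ l) \<le> C * \<rho> ^ l"
    and "\<And>l. (\<lambda>M. \<Sum>j<M. c M j * x M j ^ l) \<longlonglongrightarrow> (if l < N then d l else 0)"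
proof
  define w where "w = (\<lambda>M n::nat. exp (2 * of_real pi * \<i> * of_nat n / of_nat M) :: complex)"
  define x where "x = (\<lambda>M j::nat. of_real \<rho> * w M 1 ^ j)"
  define c where "c = (\<lambda>M j. \<Sum>n<N. d n / of_real \<rho> ^ n / w M n ^ j / of_nat M)"
  have wn: "cmod (w M n) = 1" for M n
    by (simp add: w_def exp_eq_polar norm_mult)
  show "x M j \<in> unit_disc" for M j
    using \<rho> by (simp add: x_def norm_mult norm_power wn)
  have w1: "w M 1 ^ l = w M l" for M l
    by (simp add: w_def exp_of_nat_mult[symmetric] mult_ac)
  \<comment> \<open>For given M, the n-th summand picks up every frequency congruent to n modulo M.
    This aliasing disappears as M grows, and \<open>\<rho> ^ l\<close> controls its size
    meanwhile.\<close>
  have y: "(\<Sum>j<M. c M j * x M j ^ l)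
      = (\<Sum>n<N. d n * of_real \<rho> ^ l / of_real \<rho> ^ n * ((\<Sum>j<M. (w M l / w M n) ^ j) / of_nat M))" for M l
  proof -
    have "x M j ^ l = of_real \<rho> ^ l * w M l ^ j" for j
      by (simp add: x_def power_mult_distrib w1[of M l, symmetric] mult.commute flip: power_mult)
    then have "(\<Sum>j<M. c M j * x M j ^ l)
      = (\<Sum>j<M. \<Sum>n<N. d n * of_real \<rho> ^ l / of_real \<rho> ^ n * ((w M l / w M n) ^ j / of_nat M))"
      unfolding c_def sum_distrib_right by (intro sum.cong refl) (simp add: power_divide mult_ac)
    also have "\<dots> = (\<Sum>n<N. \<Sum>j<M. d n * of_real \<rho> ^ l / of_real \<rho> ^ n * ((w M l / w M n) ^ j / of_nat M))"
      by (rule sum.swap)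
    finally show ?thesis by (simp add: sum_distrib_left sum_divide_distrib)
  qed
  show "cmod (\<Sum>j<M. c M j * x M j ^ l) \<le> (\<Sum>n<N. cmod (d n) / \<rho> ^ n) * \<rho> ^ l" for M l
    unfolding y sum_distrib_right
  proof (rule sum_norm_le)
    fix n
    have "cmod (d n * of_real \<rho> ^ l / of_real \<rho> ^ n * ((\<Sum>j<M. (w M l / w M n) ^ j) / of_nat M))
       = cmod (d n) * \<rho> ^ l / \<rho> ^ n * cmod ((\<Sum>j<M. (w M l / w M n) ^ j) / of_nat M)"
      using \<rho> by (simp add: norm_mult norm_divide norm_power)
    also have "\<dots> \<le> cmod (d n) * \<rho> ^ l / \<rho> ^ n * 1"
      using \<rho> unfolding w_def by (intro mult_left_mono root_of_unity_mean_tendsto(2)) auto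
    finally show "cmod (d n * of_real \<rho> ^ l / of_real \<rho> ^ n * ((\<Sum>j<M. (w M l / w M n) ^ j) / of_nat M))
       \<le> cmod (d n) / \<rho> ^ n * \<rho> ^ l" by simp
  qed
  show "(\<lambda>M. \<Sum>j<M. c M j * x M j ^ l) \<longlonglongrightarrow> (if l < N then d l else 0)" for l
  proof -
    have "(\<lambda>M. \<Sum>j<M. c M j * x M j ^ l) \<longlonglongrightarrow>
       (\<Sum>n<N. d n * of_real \<rho> ^ l / of_real \<rho> ^ n * (if l = n then 1 else 0))"
      unfolding y w_def by (intro tendsto_intros root_of_unity_mean_tendsto(1))
    also have "(\<Sum>n<N. d n * of_real \<rho> ^ l / of_real \<rho> ^ n * (if l = n then 1 else 0))
       = (\<Sum>n<N. if n = l then d l else 0)"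
      using \<rho> by (intro sum.cong refl) auto
    finally show ?thesis by simp
  qed
qed

lemma mult_cnj_in_disc:
  assumes "z \<in> unit_disc" "w \<in> unit_disc"
  shows "z * cnj w \<in> unit_disc"
  using assms mult_strict_mono[of "cmod z" 1 "cmod w" 1] by (simp add: norm_mult)

text \<open>Powers of \<open>z * cnj w\<close> are rank-one kernels, so a radial kernel is diagonal
  in the monomials and its form is a weighted sum of squared moments.\<close>

lemma radial_kernel_form_sums:
  fixes x c :: "nat \<Rightarrow> complex" and n :: nat
  assumes g: "\<And>u. u \<in> unit_disc \<Longrightarrow> (\<lambda>l. b l * u ^ l) sums g u"
    and x: "\<And>j. j < n \<Longrightarrow> x j \<in> unit_disc"
  shows "(\<lambda>l. b l * of_real ((cmod (\<Sum>j<n. c j * x j ^ l))\<^sup>2)) sums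
     (\<Sum>i<n. \<Sum>j<n. c i * cnj (c j) * g (x i * cnj (x j)))"
proof -
  have "(\<lambda>l. \<Sum>i<n. \<Sum>j<n. c i * cnj (c j) * (b l * (x i * cnj (x j)) ^ l)) sums
     (\<Sum>i<n. \<Sum>j<n. c i * cnj (c j) * g (x i * cnj (x j)))"
    using x by (intro sums_sum sums_mult g mult_cnj_in_disc) auto
  moreover have "(\<Sum>i<n. \<Sum>j<n. c i * cnj (c j) * (b l * (x i * cnj (x j)) ^ l))
      = b l * of_real ((cmod (\<Sum>j<n. c j * x j ^ l))\<^sup>2)" for l
  proof -
    have "of_real ((cmod (\<Sum>j<n. c j * x j ^ l))\<^sup>2)
        = (\<Sum>i<n. \<Sum>j<n. c i * cnj (c j) * (x i * cnj (x j)) ^ l)"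
      unfolding complex_norm_square by (simp add: sum_product power_mult_distrib mult_ac)
    then show ?thesis by (simp add: sum_distrib_left mult_ac del: of_real_power)
  qed
  ultimately show ?thesis by simp
qed

lemma sums_in_nonneg_Reals:
  fixes f :: "nat \<Rightarrow> complex"
  assumes "f sums s" "\<And>n. f n \<in> \<real>\<^sub>\<ge>\<^sub>0"
  shows "s \<in> \<real>\<^sub>\<ge>\<^sub>0"
proof (rule Lim_in_closed_set)
  show "(\<lambda>n. \<Sum>i<n. f i) \<longlonglongrightarrow> s" using assms(1) by (simp add: sums_def)
  show "\<forall>\<^sub>F n in sequentially. (\<Sum>i<n. f i) \<in> \<real>\<^sub>\<ge>\<^sub>0"
    by (intro always_eventually allI sum_in_nonneg_Reals assms(2))
qed auto

lemma pos_kernel_radial: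
  assumes "\<And>u. u \<in> unit_disc \<Longrightarrow> (\<lambda>l. b l * u ^ l) sums g u" "\<And>l. b l \<in> \<real>\<^sub>\<ge>\<^sub>0"
  shows "pos_kernel unit_disc (\<lambda>z w. g (z * cnj w))"
proof (rule pos_kernelI)
  fix n :: nat and x c assume "\<And>i. i < n \<Longrightarrow> x i \<in> unit_disc"
  then have "(\<lambda>l. b l * of_real ((cmod (\<Sum>j<n. c j * x j ^ l))\<^sup>2)) sums
     (\<Sum>i<n. \<Sum>j<n. c i * cnj (c j) * g (x i * cnj (x j)))"
    by (intro radial_kernel_form_sums assms(1))
  then show "(\<Sum>i<n. \<Sum>j<n. c i * cnj (c j) * g (x i * cnj (x j))) \<in> \<real>\<^sub>\<ge>\<^sub>0"
    by (rule sums_in_nonneg_Reals) (intro nonneg_Reals_mult_I assms(2), simp)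
qed

lemma norm_summable_in_disc:
  fixes b :: "nat \<Rightarrow> complex"
  assumes g: "\<And>u. u \<in> unit_disc \<Longrightarrow> (\<lambda>l. b l * u ^ l) sums g u" and "0 \<le> \<rho>" "\<rho> < 1"
  shows "summable (\<lambda>l. cmod (b l) * \<rho> ^ l)"
proof -
  obtain r where r: "\<rho> < r" "r < 1" using dense[OF assms(3)] by blast
  have "summable (\<lambda>l. b l * of_real r ^ l)"
    using g[of "of_real r"] r assms(2) by (auto simp: sums_iff)
  from powser_insidea[OF this, of "of_real \<rho>"] show ?thesis
    using r assms(2) by (simp add: norm_mult norm_power)
qed

text \<open>Point combinations whose moments tend to the indicator of \<open>n\<close> isolate
  \<open>b n\<close> as a limit of nonnegative forms. Limit and sum may be exchanged because the
  squared moments decay like 4^-l and 1/4 lies inside the disc.\<close>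

lemma pos_kernel_radial_coeffs:
  assumes g: "\<And>u. u \<in> unit_disc \<Longrightarrow> (\<lambda>l. b l * u ^ l) sums g u"
    and pos: "pos_kernel unit_disc (\<lambda>z w. g (z * cnj w))"
  shows "b n \<in> \<real>\<^sub>\<ge>\<^sub>0"
proof -
  define d where "d = (\<lambda>l. if l = n then 1 else 0 :: complex)"
  obtain x c C where x: "\<And>M j. x M j \<in> unit_disc"
    and C: "\<And>M l. cmod (\<Sum>j<M. c M j * x M j ^ l) \<le> C * (1/2) ^ l"
    and lim: "\<And>l. (\<lambda>M. \<Sum>j<M. c M j * x M j ^ l) \<longlonglongrightarrow> (if l < Suc n then d l else 0)"
    using exists_moment_functionals[of "1/2" "Suc n" d] by auto
  define y where "y = (\<lambda>M l. \<Sum>j<M. c M j * x M j ^ l)"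
  have "(\<lambda>M. \<Sum>l. b l * of_real ((cmod (y M l))\<^sup>2)) \<longlonglongrightarrow>
        (\<Sum>l. b l * of_real ((cmod (if l < Suc n then d l else 0))\<^sup>2))"
  proof (rule tannerys_theorem[THEN conjunct2, THEN conjunct2])
    show "(\<lambda>M. b l * of_real ((cmod (y M l))\<^sup>2)) \<longlonglongrightarrow>
        b l * of_real ((cmod (if l < Suc n then d l else 0))\<^sup>2)" for l
      unfolding y_def by (intro tendsto_intros lim)
    have "norm (b l * of_real ((cmod (y M l))\<^sup>2)) \<le> C\<^sup>2 * (cmod (b l) * (1/4) ^ l)" for l M
    proof -
      have "(cmod (y M l))\<^sup>2 \<le> (C * (1/2) ^ l)\<^sup>2"
        using C unfolding y_def by (intro power_mono) auto
      also have "\<dots> = C\<^sup>2 * (1/4) ^ l"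
        by (simp add: power_mult_distrib power2_eq_square flip: power_mult_distrib[of "1/2" "1/2"])
      finally show ?thesis
        by (simp add: norm_mult mult.left_commute[of "C\<^sup>2"] mult_left_mono norm_power del: of_real_power)
    qed
    then show "\<forall>\<^sub>F (l, M) in sequentially \<times>\<^sub>F sequentially.
       norm (b l * of_real ((cmod (y M l))\<^sup>2)) \<le> C\<^sup>2 * (cmod (b l) * (1/4) ^ l)"
      by (intro always_eventually) auto
    show "summable (\<lambda>l. C\<^sup>2 * (cmod (b l) * (1/4) ^ l))"
      by (intro summable_mult norm_summable_in_disc[OF g]) auto
  qed simp
  also have "(\<Sum>l. b l * of_real ((cmod (if l < Suc n then d l else 0))\<^sup>2)) = (\<Sum>l\<in>{n}. b l)"
    by (subst suminf_finite[of "{n}"]) (auto simp: d_def)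
  finally have "(\<lambda>M. \<Sum>l. b l * of_real ((cmod (y M l))\<^sup>2)) \<longlonglongrightarrow> b n" by simp
  moreover have "(\<Sum>l. b l * of_real ((cmod (y M l))\<^sup>2)) \<in> \<real>\<^sub>\<ge>\<^sub>0" for M
    using radial_kernel_form_sums[OF g, where n = M and x = "x M" and c = "c M"] x
      pos_kernel_finite[OF pos, where I = "{..<M}" and x = "x M" and c = "c M"]
    unfolding y_def by (simp add: sums_iff)
  ultimately show ?thesis
    by (intro Lim_in_closed_set[of "\<real>\<^sub>\<ge>\<^sub>0" _ sequentially]) auto
qed

section \<open>The Szego kernel and square-summable Taylor coefficients\<close>

definition szego :: "complex \<Rightarrow> complex \<Rightarrow> complex" where
  "szego z w = 1 / (1 - z * cnj w)"

lemma geometric_sums_disc: "u \<in> unit_disc \<Longrightarrow> (\<lambda>l. 1 * u ^ l) sums (1 / (1 - u))" for u :: complex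
  using geometric_sums[of u] by simp

text \<open>Written in the moments \<open>y\<close>, domination by the Szego kernel is
  Cauchy-Schwarz for the pairing of \<open>y\<close> with the Taylor coefficients. Both directions
  of the comparison with square summability rest on this.\<close>

lemma szego_minus_rank_one_form:
  fixes x c :: "nat \<Rightarrow> complex" and n :: nat
  assumes f: "\<And>z. z \<in> unit_disc \<Longrightarrow> (\<lambda>l. a l * z ^ l) sums f z"
    and x: "\<And>j. j < n \<Longrightarrow> x j \<in> unit_disc"
  defines "y \<equiv> (\<lambda>l. \<Sum>j<n. c j * x j ^ l)"
  shows "summable (\<lambda>l. (cmod (y l))\<^sup>2)" "summable (\<lambda>l. a l * y l)"
    "(\<Sum>i<n. \<Sum>j<n. c i * cnj (c j) * (of_real t * szego (x i) (x j) - f (x i) * cnj (f (x j))))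
      = of_real (t * (\<Sum>l. (cmod (y l))\<^sup>2) - (cmod (\<Sum>l. a l * y l))\<^sup>2)"
proof -
  have "(\<lambda>l. of_real ((cmod (y l))\<^sup>2)) sums (\<Sum>i<n. \<Sum>j<n. c i * cnj (c j) * szego (x i) (x j))"
    using radial_kernel_form_sums[OF geometric_sums_disc x, where c = c] by (simp add: y_def szego_def)
  then have *: "summable (\<lambda>l. (cmod (y l))\<^sup>2)"
    "(\<Sum>i<n. \<Sum>j<n. c i * cnj (c j) * szego (x i) (x j)) = of_real (\<Sum>l. (cmod (y l))\<^sup>2)"
    by (auto simp: sums_iff summable_complex_of_real suminf_of_real simp del: of_real_power)
  have "(\<lambda>l. \<Sum>j<n. c j * (a l * x j ^ l)) sums (\<Sum>j<n. c j * f (x j))"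
    using x by (intro sums_sum sums_mult f) auto
  also have "(\<lambda>l. \<Sum>j<n. c j * (a l * x j ^ l)) = (\<lambda>l. a l * y l)"
    by (simp add: y_def sum_distrib_left mult_ac)
  finally have **: "summable (\<lambda>l. a l * y l)" "(\<Sum>l. a l * y l) = (\<Sum>j<n. c j * f (x j))"
    by (auto simp: sums_iff)
  show "summable (\<lambda>l. (cmod (y l))\<^sup>2)" "summable (\<lambda>l. a l * y l)" by fact+
  have "of_real ((cmod (\<Sum>l. a l * y l))\<^sup>2) = (\<Sum>i<n. \<Sum>j<n. c i * cnj (c j) * (f (x i) * cnj (f (x j))))"
    unfolding complex_norm_square **(2) by (simp add: sum_product mult_ac)
  then show "(\<Sum>i<n. \<Sum>j<n. c i * cnj (c j) * (of_real t * szego (x i) (x j) - f (x i) * cnj (f (x j))))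
      = of_real (t * (\<Sum>l. (cmod (y l))\<^sup>2) - (cmod (\<Sum>l. a l * y l))\<^sup>2)"
    by (simp add: *(2)[symmetric] right_diff_distrib sum_subtractf sum_distrib_left mult_ac del: of_real_power)
qed

lemma pos_kernel_szego_imp_coeffs:
  assumes f: "\<And>z. z \<in> unit_disc \<Longrightarrow> (\<lambda>l. a l * z ^ l) sums f z"
    and pos: "pos_kernel unit_disc (\<lambda>z w. of_real t * szego z w - f z * cnj (f w))" and "0 \<le> t"
  shows "(\<Sum>l<N. (cmod (a l))\<^sup>2) \<le> t"
proof -
  \<comment> \<open>Conjugated and truncated coefficients are the equality case of Cauchy-Schwarz;
    they reduce positivity to T^2 \<le> t T for the partial sum \<open>T\<close>.\<close>
  define d where "d = (\<lambda>l. if l < N then cnj (a l) else 0)"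
  obtain x c C where x: "\<And>M j. x M j \<in> unit_disc"
    and C: "\<And>M l. cmod (\<Sum>j<M. c M j * x M j ^ l) \<le> C * (1/2) ^ l"
    and lim: "\<And>l. (\<lambda>M. \<Sum>j<M. c M j * x M j ^ l) \<longlonglongrightarrow> d l"
    using exists_moment_functionals[of "1/2" N "\<lambda>l. cnj (a l)"] by (auto simp: d_def)
  define y where "y = (\<lambda>M l. \<Sum>j<M. c M j * x M j ^ l)"
  have lim1: "(\<lambda>M. \<Sum>l. (cmod (y M l))\<^sup>2) \<longlonglongrightarrow> (\<Sum>l. (cmod (d l))\<^sup>2)"
  proof (rule tannerys_theorem[THEN conjunct2, THEN conjunct2])
    show "(\<lambda>M. (cmod (y M l))\<^sup>2) \<longlonglongrightarrow> (cmod (d l))\<^sup>2" for l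
      unfolding y_def by (intro tendsto_intros lim)
    have "norm ((cmod (y M l))\<^sup>2) \<le> C\<^sup>2 * (1/4) ^ l" for l M
    proof -
      have "(cmod (y M l))\<^sup>2 \<le> (C * (1/2) ^ l)\<^sup>2"
        using C unfolding y_def by (intro power_mono) auto
      also have "\<dots> = C\<^sup>2 * (1/4) ^ l"
        by (simp add: power_mult_distrib power2_eq_square flip: power_mult_distrib[of "1/2" "1/2"])
      finally show ?thesis by simp
    qed
    then show "\<forall>\<^sub>F (l, M) in sequentially \<times>\<^sub>F sequentially. norm ((cmod (y M l))\<^sup>2) \<le> C\<^sup>2 * (1/4) ^ l"
      by (intro always_eventually) auto
  qed (auto intro: summable_mult)
  have lim2: "(\<lambda>M. \<Sum>l. a l * y M l) \<longlonglongrightarrow> (\<Sum>l. a l * d l)"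
  proof (rule tannerys_theorem[THEN conjunct2, THEN conjunct2])
    show "(\<lambda>M. a l * y M l) \<longlonglongrightarrow> a l * d l" for l
      unfolding y_def by (intro tendsto_intros lim)
    have "norm (a l * y M l) \<le> C * (cmod (a l) * (1/2) ^ l)" for l M
      using mult_left_mono[OF C[of M l], of "cmod (a l)"] by (simp add: norm_mult y_def mult_ac)
    then show "\<forall>\<^sub>F (l, M) in sequentially \<times>\<^sub>F sequentially. norm (a l * y M l) \<le> C * (cmod (a l) * (1/2) ^ l)"
      by (intro always_eventually) auto
    show "summable (\<lambda>l. C * (cmod (a l) * (1/2) ^ l))"
      by (intro summable_mult norm_summable_in_disc[OF f]) auto
  qed simp
  define T where "T = (\<Sum>l<N. (cmod (a l))\<^sup>2)"
  have s1: "(\<Sum>l. (cmod (d l))\<^sup>2) = T"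
    by (subst suminf_finite[of "{..<N}"]) (auto simp: d_def T_def)
  have s2: "(\<Sum>l. a l * d l) = of_real T"
    by (subst suminf_finite[of "{..<N}"]) (auto simp: d_def T_def complex_norm_square simp del: of_real_power)
  have "0 \<le> t * (\<Sum>l. (cmod (y M l))\<^sup>2) - (cmod (\<Sum>l. a l * y M l))\<^sup>2" for M
    using szego_minus_rank_one_form(3)[OF f, where n = M and x = "x M" and c = "c M" and t = t] x
      pos_kernel_finite[OF pos, where I = "{..<M}" and x = "x M" and c = "c M"]
    by (simp add: y_def del: of_real_diff of_real_mult of_real_power)
  moreover have "(\<lambda>M. t * (\<Sum>l. (cmod (y M l))\<^sup>2) - (cmod (\<Sum>l. a l * y M l))\<^sup>2) \<longlonglongrightarrow>
      t * T - (cmod (of_real T))\<^sup>2"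
    using lim1 lim2 unfolding s1 s2 by (intro tendsto_intros)
  ultimately have "0 \<le> t * T - (cmod (of_real T))\<^sup>2"
    by (intro tendsto_lowerbound[of _ _ sequentially]) auto
  then have "T * T \<le> t * T" by (simp add: power2_eq_square)
  moreover have "0 \<le> T" by (simp add: T_def sum_nonneg)
  ultimately show ?thesis
    unfolding T_def[symmetric] using \<open>0 \<le> t\<close> by (cases "T = 0") auto
qed

lemma pos_kernel_szego_minus_rank_one:
  assumes f: "\<And>z. z \<in> unit_disc \<Longrightarrow> (\<lambda>l. a l * z ^ l) sums f z"
    and sm: "summable (\<lambda>l. (cmod (a l))\<^sup>2)"
  shows "pos_kernel unit_disc (\<lambda>z w. of_real (\<Sum>l. (cmod (a l))\<^sup>2) * szego z w - f z * cnj (f w))"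
proof (rule pos_kernelI)
  fix n :: nat and x c assume x: "\<And>i. i < n \<Longrightarrow> x i \<in> unit_disc"
  define y where "y = (\<lambda>l. \<Sum>j<n. c j * x j ^ l)"
  have form: "summable (\<lambda>l. (cmod (y l))\<^sup>2)" "summable (\<lambda>l. a l * y l)"
    "(\<Sum>i<n. \<Sum>j<n. c i * cnj (c j) * (of_real t * szego (x i) (x j) - f (x i) * cnj (f (x j))))
      = of_real (t * (\<Sum>l. (cmod (y l))\<^sup>2) - (cmod (\<Sum>l. a l * y l))\<^sup>2)" for t
    unfolding y_def by (rule szego_minus_rank_one_form[OF f x]; assumption)+
  have "(cmod (\<Sum>l. a l * y l))\<^sup>2 \<le> (\<Sum>l. (cmod (a l))\<^sup>2) * (\<Sum>l. (cmod (y l))\<^sup>2)"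
  proof (rule tendsto_upperbound)
    show "(\<lambda>N. (cmod (\<Sum>l<N. a l * y l))\<^sup>2) \<longlonglongrightarrow> (cmod (\<Sum>l. a l * y l))\<^sup>2"
      by (intro tendsto_intros summable_LIMSEQ form(2))
    have "(cmod (\<Sum>l<N. a l * y l))\<^sup>2 \<le> (\<Sum>l. (cmod (a l))\<^sup>2) * (\<Sum>l. (cmod (y l))\<^sup>2)" for N
    proof -
      have "cmod (\<Sum>l<N. a l * y l) \<le> (\<Sum>l<N. cmod (a l) * cmod (y l))"
        by (rule sum_norm_le) (simp add: norm_mult)
      then have "(cmod (\<Sum>l<N. a l * y l))\<^sup>2 \<le> (\<Sum>l<N. cmod (a l) * cmod (y l))\<^sup>2"
        by (intro power_mono) auto
      also have "\<dots> \<le> (\<Sum>l<N. (cmod (a l))\<^sup>2) * (\<Sum>l<N. (cmod (y l))\<^sup>2)"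
        by (rule Cauchy_Schwarz_ineq_sum)
      also have "\<dots> \<le> (\<Sum>l. (cmod (a l))\<^sup>2) * (\<Sum>l. (cmod (y l))\<^sup>2)"
        using sm form(1) by (intro mult_mono sum_le_suminf suminf_nonneg sum_nonneg) auto
      finally show ?thesis .
    qed
    then show "\<forall>\<^sub>F N in sequentially. (cmod (\<Sum>l<N. a l * y l))\<^sup>2 \<le> (\<Sum>l. (cmod (a l))\<^sup>2) * (\<Sum>l. (cmod (y l))\<^sup>2)"
      by simp
  qed simp
  then show "(\<Sum>i<n. \<Sum>j<n. c i * cnj (c j) * (of_real (\<Sum>l. (cmod (a l))\<^sup>2) * szego (x i) (x j) - f (x i) * cnj (f (x j)))) \<in> \<real>\<^sub>\<ge>\<^sub>0"
    unfolding form(3) by (simp del: of_real_diff of_real_mult of_real_power)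
qed

section \<open>Reciprocals of rational power series\<close>

text \<open>A quotient of polynomials can be bounded on the disc although its denominator has zeros on the
  circle; these are shared by the numerator.\<close>

lemma bounded_rational_reduce:
  fixes p r :: "complex poly"
  assumes "\<And>u. u \<in> unit_disc \<Longrightarrow> poly r u \<noteq> 0"
    and "\<And>u. u \<in> unit_disc \<Longrightarrow> cmod (poly p u) \<le> B * cmod (poly r u)"
  shows "\<exists>p' r'. (\<forall>u\<in>cball 0 1. poly r' u \<noteq> 0) \<and>
    (\<forall>u\<in>unit_disc. poly p' u * poly r u = poly p u * poly r' u)"
  using assms
proof (induction "degree r" arbitrary: p r rule: less_induct)
  case less
  show ?case
  proof (cases "\<forall>u\<in>cball 0 1. poly r u \<noteq> 0")
    case True
    then show ?thesis by (intro exI[of _ p] exI[of _ r]) auto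
  next
    case False
    then obtain \<zeta> where \<zeta>: "cmod \<zeta> \<le> 1" "poly r \<zeta> = 0" by auto
    have r0: "r \<noteq> 0" using less.prems(1)[of 0] by auto
    \<comment> \<open>The bound passes to the closed disc by continuity, so a zero of
      \<open>r\<close> on the circle is also a zero of \<open>p\<close> and the common linear factor
      can be cancelled.\<close>
    have "closed {u. cmod (poly p u) \<le> B * cmod (poly r u)}"
      by (intro closed_Collect_le continuous_intros)
    moreover have "unit_disc \<subseteq> {u. cmod (poly p u) \<le> B * cmod (poly r u)}"
      using less.prems(2) by auto
    ultimately have "closure unit_disc \<subseteq> {u. cmod (poly p u) \<le> B * cmod (poly r u)}"
      by (rule closure_minimal[rotated])
    moreover have "\<zeta> \<in> closure unit_disc" using \<zeta>(1) by simp
    ultimately have "poly p \<zeta> = 0" using \<zeta>(2) by auto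
    then obtain p1 where p1: "p = [:-\<zeta>, 1:] * p1" by (metis dvdE poly_eq_0_iff_dvd)
    obtain r1 where r1: "r = [:-\<zeta>, 1:] * r1" using \<zeta>(2) by (metis dvdE poly_eq_0_iff_dvd)
    have "r1 \<noteq> 0" using r0 r1 by auto
    then have "degree r = Suc (degree r1)" unfolding r1 by (subst degree_mult_eq) auto
    then have "degree r1 < degree r" by simp
    moreover have nz: "poly r1 u \<noteq> 0" if "u \<in> unit_disc" for u
      using less.prems(1)[OF that] r1 by auto
    moreover have "cmod (poly p1 u) \<le> B * cmod (poly r1 u)" if "u \<in> unit_disc" for u
    proof -
      have "u \<noteq> \<zeta>" using less.prems(1)[OF that] \<zeta>(2) by auto
      then have "0 < cmod (u - \<zeta>)" by simp
      moreover have "cmod (u - \<zeta>) * cmod (poly p1 u) \<le> cmod (u - \<zeta>) * (B * cmod (poly r1 u))"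
        using less.prems(2)[OF that] unfolding p1 r1 by (simp add: norm_mult[symmetric] mult.left_commute[of B] algebra_simps)
      ultimately show ?thesis by (simp only: mult_le_cancel_left_pos)
    qed
    ultimately obtain p' r' where *: "\<forall>u\<in>cball 0 1. poly r' u \<noteq> 0"
      "\<forall>u\<in>unit_disc. poly p' u * poly r1 u = poly p1 u * poly r' u"
      using less.hyps[of r1 p1] by blast
    have "poly p' u * poly r u = poly p u * poly r' u" if "u \<in> unit_disc" for u
    proof -
      have "(u - \<zeta>) * (poly p' u * poly r1 u) = (u - \<zeta>) * (poly p1 u * poly r' u)"
        using *(2) that by simp
      then show ?thesis by (simp add: p1 r1 algebra_simps)
    qed
    with *(1) show ?thesis by blast
  qed
qed

lemma poly_nonzero_larger_disc:
  fixes P :: "complex poly"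
  assumes "\<And>u. cmod u \<le> 1 \<Longrightarrow> poly P u \<noteq> 0"
  obtains R where "R > 1" "\<And>u. u \<in> ball 0 R \<Longrightarrow> poly P u \<noteq> 0"
proof -
  have "P \<noteq> 0" using assms[of 0] by auto
  then have fin: "finite (insert 2 (cmod ` {u. poly P u = 0}))" by (simp add: poly_roots_finite)
  show thesis
  \<comment> \<open>Inserting 2 keeps the set nonempty for a polynomial without roots.\<close>
  proof (rule that[of "Min (insert 2 (cmod ` {u. poly P u = 0}))"])
    show "1 < Min (insert 2 (cmod ` {u. poly P u = 0}))"
    proof (subst Min_gr_iff[OF fin])
      show "\<forall>t\<in>insert 2 (cmod ` {u. poly P u = 0}). 1 < t"
        using assms by (auto simp: not_le[symmetric])
    qed simp
    show "poly P u \<noteq> 0" if "u \<in> ball 0 (Min (insert 2 (cmod ` {u. poly P u = 0})))" for u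
      using that fin by (auto simp: Min_gr_iff simp del: Min_insert)
  qed
qed

lemma power_series_coeff_unique:
  assumes "\<And>u. u \<in> unit_disc \<Longrightarrow> (\<lambda>n. g n * u ^ n) sums f u"
  shows "g n = (deriv ^^ n) f 0 / fact n"
proof -
  have "eventually (\<lambda>u::complex. u \<in> unit_disc) (nhds 0)"
    by (rule eventually_nhds_in_open) auto
  then have "eventually (\<lambda>u. (\<lambda>n. fps_nth (Abs_fps g) n * u ^ n) sums f u) (nhds 0)"
    by eventually_elim (use assms in auto)
  then have "f has_fps_expansion Abs_fps g" by (rule has_fps_expansionI)
  from fps_nth_fps_expansion[OF this, of n] show ?thesis by simp
qed

text \<open>Each partial sum is a polynomial, so its bound survives the passage to x = 1;
  nonnegative terms with bounded partial sums are summable.\<close>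

lemma nonneg_power_series_at_one:
  fixes b :: "nat \<Rightarrow> real"
  assumes b: "\<And>n. 0 \<le> b n" and c: "\<And>x N. 0 \<le> x \<Longrightarrow> x < 1 \<Longrightarrow> (\<Sum>n<N. b n * x ^ n) \<le> c"
  shows "summable b" "suminf b \<le> c"
proof -
  have le: "(\<Sum>n<N. b n) \<le> c" for N
  proof -
    have "((\<lambda>x. \<Sum>n<N. b n * x ^ n) \<longlongrightarrow> (\<Sum>n<N. b n * 1 ^ n)) (at_left (1::real))"
      by (intro tendsto_intros)
    moreover have "eventually (\<lambda>x::real. x \<in> {0<..<1}) (at_left 1)"
      by (rule eventually_at_left_real) simp
    then have "eventually (\<lambda>x. (\<Sum>n<N. b n * x ^ n) \<le> c) (at_left (1::real))"
      by eventually_elim (use c in auto)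
    ultimately show ?thesis by (simp add: tendsto_upperbound)
  qed
  show "summable b" using b le by (rule summableI_nonneg_bounded)
  then show "suminf b \<le> c" using le by (rule suminf_le_const)
qed

lemma continuous_on_abs_summable_powser:
  fixes b :: "nat \<Rightarrow> real"
  assumes "summable b" "\<And>n. 0 \<le> b n"
  shows "continuous_on (cball 0 1) (\<lambda>u::complex. \<Sum>n. of_real (b n) * u ^ n)"
proof (rule uniform_limit_theorem)
  show "uniform_limit (cball 0 1) (\<lambda>N u. \<Sum>n<N. of_real (b n) * u ^ n) (\<lambda>u::complex. \<Sum>n. of_real (b n) * u ^ n) sequentially"
    using assms by (intro Weierstrass_m_test[where M = b])
      (auto simp: norm_mult norm_power mult_left_le power_le_one)
qed (auto intro!: always_eventually continuous_intros)

lemma abs_summable_powser: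
  fixes b :: "nat \<Rightarrow> real"
  assumes "summable b" "\<And>n. 0 \<le> b n" "cmod u \<le> 1"
  shows "(\<lambda>n. of_real (b n) * u ^ n) sums (\<Sum>n. of_real (b n) * u ^ n)"
    "cmod (\<Sum>n. of_real (b n) * u ^ n) \<le> suminf b"
proof -
  have n: "norm (of_real (b n) * u ^ n) \<le> b n" for n
    using assms by (simp add: norm_mult norm_power mult_left_le power_le_one)
  have s: "summable (\<lambda>n. norm (of_real (b n) * u ^ n))"
    by (rule summable_comparison_test'[where N = 0, OF assms(1)]) (use n in simp)
  then show "(\<lambda>n. of_real (b n) * u ^ n) sums (\<Sum>n. of_real (b n) * u ^ n)"
    by (rule summable_sums[OF summable_norm_cancel])
  have "cmod (\<Sum>n. of_real (b n) * u ^ n) \<le> (\<Sum>n. norm (of_real (b n) * u ^ n))"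
    by (rule summable_norm[OF s])
  also have "\<dots> \<le> suminf b" by (rule suminf_le[OF n s assms(1)])
  finally show "cmod (\<Sum>n. of_real (b n) * u ^ n) \<le> suminf b" .
qed

section \<open>Renewal recursion and limits of coefficients\<close>

lemma renewal_coeffs_pos:
  fixes a :: "nat \<Rightarrow> complex" and b :: "nat \<Rightarrow> real" and c :: real
  assumes c: "0 < c" and b: "\<And>n. 0 \<le> b n" "0 < b 1" and a0: "of_real c * a 0 = 1"
    and rec: "\<And>n. of_real c * a (Suc n) = (\<Sum>k\<le>n. of_real (b (Suc k)) * a (n - k))"
  shows "Im (a n) = 0 \<and> 0 < Re (a n)"
proof (induction n rule: less_induct)
  case (less n)
  show ?case
  proof (cases n)
    case 0
    have "a 0 = of_real (1 / c)" using a0 c by (simp add: field_simps)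
    then show ?thesis using 0 c by (simp del: of_real_divide)
  next
    case (Suc m)
    have IH: "Im (a (m - k)) = 0" "0 < Re (a (m - k))" if "k \<le> m" for k
      using less[of "m - k"] Suc by auto
    have "c * Im (a n) = (\<Sum>k\<le>m. b (Suc k) * Im (a (m - k)))"
      using arg_cong[OF rec[of m], of Im] by (simp add: Suc)
    also have "\<dots> = 0" using IH by (intro sum.neutral) auto
    finally have "Im (a n) = 0" using c by simp
    \<comment> \<open>The term k = 0 pairs b_1 > 0 with the preceding coefficient; it alone yields
      strict positivity, the other terms being nonnegative.\<close>
    moreover have "0 < b (Suc 0) * Re (a (m - 0))" using b(2) IH[of 0] by simp
    have "b (Suc 0) * Re (a (m - 0)) \<le> (\<Sum>k\<le>m. b (Suc k) * Re (a (m - k)))"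
      using b(1) IH(2) by (intro member_le_sum) (auto intro!: mult_nonneg_nonneg dest: less_imp_le)
    then have "0 < c * Re (a n)"
      using \<open>0 < b (Suc 0) * _\<close> arg_cong[OF rec[of m], of Re] by (simp add: Suc)
    ultimately show ?thesis using c by (simp add: zero_less_mult_iff)
  qed
qed

text \<open>The Cauchy product of \<open>c - q\<close> with its reciprocal is 1, and power series
  coefficients are unique.\<close>

lemma reciprocal_powser_recursion:
  fixes a :: "nat \<Rightarrow> complex" and b :: "nat \<Rightarrow> real" and c :: real
  assumes q: "\<And>u. u \<in> unit_disc \<Longrightarrow> (\<lambda>n. of_real (b n) * u ^ n) sums q u" and b0: "b 0 = 0"
    and nz: "\<And>u. u \<in> unit_disc \<Longrightarrow> q u \<noteq> of_real c"
    and a: "\<And>u. u \<in> unit_disc \<Longrightarrow> (\<lambda>n. a n * u ^ n) sums (1 / (of_real c - q u))"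
  shows "of_real c * a 0 = 1"
    and "of_real c * a (Suc n) = (\<Sum>k\<le>n. of_real (b (Suc k)) * a (n - k))"
proof -
  define e where "e n = (if n = 0 then of_real c else - of_real (b n) :: complex)" for n
  have e: "(\<lambda>n. e n * u ^ n) sums (of_real c - q u)" if "u \<in> unit_disc" for u
  proof -
    have "(\<lambda>n. (if n = 0 then of_real c else 0) - of_real (b n) * u ^ n) sums (of_real c - q u)"
      using sums_diff[OF sums_single[of 0 "\<lambda>_. of_real c"] q[OF that]] by (simp cong: if_cong)
    moreover have "(if n = 0 then of_real c else 0) - of_real (b n) * u ^ n = e n * u ^ n" for n
      by (simp add: e_def b0)
    ultimately show ?thesis by simp
  qed
  define g where "g n = (\<Sum>k\<le>n. e k * a (n - k))" for n
  have g: "(\<lambda>n. g n * u ^ n) sums 1" if u: "u \<in> unit_disc" for u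
  proof -
    have "summable (\<lambda>n. norm (e n * u ^ n))" "summable (\<lambda>n. norm (a n * u ^ n))"
      using norm_summable_in_disc[OF e, of "cmod u"] norm_summable_in_disc[OF a, of "cmod u"] u
      by (simp_all add: norm_mult norm_power)
    from Cauchy_product_sums[OF this]
    have "(\<lambda>n. \<Sum>k\<le>n. e k * u ^ k * (a (n - k) * u ^ (n - k))) sums
       ((of_real c - q u) * (1 / (of_real c - q u)))"
      using e[OF u] a[OF u] by (simp add: sums_iff)
    moreover have "(\<Sum>k\<le>n. e k * u ^ k * (a (n - k) * u ^ (n - k))) = g n * u ^ n" for n
    proof -
      have "e k * u ^ k * (a (n - k) * u ^ (n - k)) = e k * a (n - k) * u ^ n" if "k \<le> n" for k
        using that by (simp add: mult_ac flip: power_add)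
      then have "(\<Sum>k\<le>n. e k * u ^ k * (a (n - k) * u ^ (n - k))) = (\<Sum>k\<le>n. e k * a (n - k) * u ^ n)"
        by (intro sum.cong refl) auto
      then show ?thesis by (simp add: g_def sum_distrib_right)
    qed
    ultimately show ?thesis using nz[OF u] by simp
  qed
  have "(\<lambda>n. (if n = 0 then 1 else 0) * u ^ n) sums (1::complex)" for u :: complex
    using sums_single[of 0 "\<lambda>_. 1::complex"] by (simp add: if_distrib[of "\<lambda>x. x * _"] cong: if_cong)
  then have geq: "g n = (if n = 0 then 1 else 0)" for n
    using power_series_coeff_unique[of g "\<lambda>_. 1" n, OF g]
      power_series_coeff_unique[of "\<lambda>n. if n = 0 then 1 else 0" "\<lambda>_. 1" n] by metis
  show "of_real c * a 0 = 1" using geq[of 0] by (simp add: g_def e_def)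
  have "0 = g (Suc n)" using geq by simp
  also have "\<dots> = of_real c * a (Suc n) - (\<Sum>k\<le>n. of_real (b (Suc k)) * a (n - k))"
    unfolding g_def sum.atMost_Suc_shift by (simp add: e_def sum_negf)
  finally show "of_real c * a (Suc n) = (\<Sum>k\<le>n. of_real (b (Suc k)) * a (n - k))" by simp
qed

text \<open>The reciprocals converge as well since the limit is positive; the inverse of a bound for
  them is the lower bound.\<close>

lemma pos_seq_pos_limit_bounds:
  fixes a :: "nat \<Rightarrow> real"
  assumes "a \<longlonglongrightarrow> L" "0 < L" "\<And>n. 0 < a n"
  obtains m M where "0 < m" "0 < M" "\<And>n. m \<le> a n" "\<And>n. a n \<le> M"
proof -
  have "Bseq a" using assms(1) by (intro convergent_imp_Bseq convergentI)
  then obtain M where M: "0 < M" "\<And>n. norm (a n) \<le> M" by (auto elim: BseqE)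
  have "(\<lambda>n. inverse (a n)) \<longlonglongrightarrow> inverse L" using assms by (intro tendsto_inverse) auto
  then have "Bseq (\<lambda>n. inverse (a n))" by (intro convergent_imp_Bseq convergentI)
  then obtain K where K: "0 < K" "\<And>n. norm (inverse (a n)) \<le> K" by (auto elim: BseqE)
  show thesis
  proof (rule that[of "inverse K" M])
    show "inverse K \<le> a n" for n
      using K(2)[of n] K(1) assms(3)[of n] by (simp add: field_simps)
    show "a n \<le> M" for n using M(2)[of n] assms(3)[of n] by simp
  qed (use K M in auto)
qed

text \<open>Division by 1 - u is a Cauchy product with the geometric series, so it replaces Taylor
  coefficients by their partial sums. These converge because 1 lies inside the larger disc.\<close>

lemma simple_pole_coeffs:
  assumes "1 < R" and h: "h holomorphic_on ball 0 R"
  defines "s \<equiv> (\<lambda>n. \<Sum>k\<le>n. (deriv ^^ k) h 0 / fact k)"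
  shows "u \<in> unit_disc \<Longrightarrow> (\<lambda>n. s n * u ^ n) sums (h u / (1 - u))"
    and "s \<longlonglongrightarrow> h 1"
proof -
  define e where "e n = (deriv ^^ n) h 0 / fact n" for n
  have e: "(\<lambda>n. e n * w ^ n) sums h w" if "w \<in> ball 0 R" for w
    using holomorphic_power_series[OF h that] by (simp add: e_def)
  have "e sums h 1" using e[of 1] assms(1) by simp
  then show "s \<longlonglongrightarrow> h 1" by (simp add: sums_def_le s_def e_def)
  assume u: "u \<in> unit_disc"
  have ed: "(\<lambda>n. e n * w ^ n) sums h w" if "w \<in> unit_disc" for w
    using e that assms(1) by simp
  have "summable (\<lambda>n. norm (e n * u ^ n))" "summable (\<lambda>n. norm (u ^ n))"
    using norm_summable_in_disc[OF ed, of "cmod u"] u by (simp_all add: norm_mult norm_power)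
  from Cauchy_product_sums[OF this]
  have "(\<lambda>n. \<Sum>k\<le>n. e k * u ^ k * u ^ (n - k)) sums (h u * (1 / (1 - u)))"
    using ed[OF u] geometric_sums[of u] u by (simp add: sums_iff)
  moreover have "(\<Sum>k\<le>n. e k * u ^ k * u ^ (n - k)) = s n * u ^ n" for n
  proof -
    have "(\<Sum>k\<le>n. e k * u ^ k * u ^ (n - k)) = (\<Sum>k\<le>n. e k * u ^ n)"
      by (intro sum.cong refl) (simp add: mult.assoc flip: power_add)
    then show ?thesis by (simp add: s_def e_def sum_distrib_right)
  qed
  ultimately show "(\<lambda>n. s n * u ^ n) sums (h u / (1 - u))" by simp
qed

lemma rational_reciprocal_coeffs:
  fixes p r :: "complex poly" and b :: "nat \<Rightarrow> real" and c :: real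
  assumes r: "\<And>u. u \<in> unit_disc \<Longrightarrow> poly r u \<noteq> 0"
    and q: "\<And>u. u \<in> unit_disc \<Longrightarrow> (\<lambda>n. of_real (b n) * u ^ n) sums (poly p u / poly r u)"
    and b: "\<And>n. 0 \<le> b n" "b 0 = 0" "0 < b 1" and c: "0 < c"
    and lt: "\<And>x N. 0 \<le> x \<Longrightarrow> x < 1 \<Longrightarrow> (\<Sum>n<N. b n * x ^ n) \<le> c"
    and nz: "\<And>u. u \<in> unit_disc \<Longrightarrow> poly p u / poly r u \<noteq> of_real c"
    and no_ext: "\<not> (\<exists>R>1. \<exists>h. h holomorphic_on ball 0 R \<and>
       (\<forall>u\<in>unit_disc. h u = 1 / (of_real c - poly p u / poly r u)))"
  obtains a :: "nat \<Rightarrow> real" and m M where "0 < m" "0 < M" "\<And>n. m \<le> a n" "\<And>n. a n \<le> M"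
    "\<And>u. u \<in> unit_disc \<Longrightarrow> (\<lambda>n. of_real (a n) * u ^ n) sums (1 / (of_real c - poly p u / poly r u))"
proof -
  note b_sum = nonneg_power_series_at_one[OF b(1) lt]
  \<comment> \<open>The series extends the quotient continuously to the closed disc, bounded by
    \<open>c\<close>, even where \<open>r\<close> vanishes on the circle.\<close>
  define Q where "Q u = (\<Sum>n. of_real (b n) * u ^ n)" for u :: complex
  have Qq: "Q u = poly p u / poly r u" if "u \<in> unit_disc" for u
    using q[OF that] by (simp add: sums_iff Q_def)
  have Qs: "(\<lambda>n. of_real (b n) * u ^ n) sums Q u" "cmod (Q u) \<le> c" if "cmod u \<le> 1" for u
    using abs_summable_powser[OF b_sum(1) b(1) that] b_sum(2) by (simp_all add: Q_def)
  have Qc: "continuous_on (cball 0 1) Q"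
    unfolding Q_def by (rule continuous_on_abs_summable_powser[OF b_sum(1) b(1)])
  have "cmod (poly p u) \<le> c * cmod (poly r u)" if "u \<in> unit_disc" for u
    using Qs(2)[of u] Qq[OF that] r[OF that] that by (simp add: norm_divide field_simps)
  from bounded_rational_reduce[OF r this]
  obtain p' r' where r'0: "\<forall>u\<in>cball 0 1. poly r' u \<noteq> 0"
    and pr: "\<forall>u\<in>unit_disc. poly p' u * poly r u = poly p u * poly r' u" by blast
  have r': "poly r' u \<noteq> 0" if "cmod u \<le> 1" for u using r'0 that by simp
  have Q': "poly p' u = Q u * poly r' u" if "cmod u \<le> 1" for u
  proof -
    have "poly p' u - Q u * poly r' u = 0"
    proof (rule continuous_constant_on_closure[where S = unit_disc and f = "\<lambda>u. poly p' u - Q u * poly r' u"])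
      show "continuous_on (closure unit_disc) (\<lambda>u. poly p' u - Q u * poly r' u)"
        using Qc by (auto intro!: continuous_intros)
      show "poly p' x - Q x * poly r' x = 0" if "x \<in> unit_disc" for x
      proof -
        have "poly p' x * poly r x = (Q x * poly r' x) * poly r x"
          using pr Qq[OF that] r[OF that] that by simp
        then show ?thesis using r[OF that] by simp
      qed
    qed (use that in auto)
    then show ?thesis by simp
  qed
  \<comment> \<open>\<open>P\<close> is the numerator of c - q after cancellation; on the closed
    disc its zeros are those of \<open>c - Q\<close>.\<close>
  define P where "P = smult (of_real c) r' - p'"
  have P: "poly P u = poly r' u * (of_real c - Q u)" if "cmod u \<le> 1" for u
    using Q'[OF that] by (simp add: P_def algebra_simps)
  have f: "1 / (of_real c - poly p u / poly r u) = poly r' u / poly P u" if "u \<in> unit_disc" for u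
    using P[of u] r'[of u] Qq[OF that] that by simp
  \<comment> \<open>At a zero, the terms \<open>b n - b n * Re (u ^ n)\<close> sum to
    \<open>suminf b - c\<close>, which is at most 0. All of them are nonnegative, so the term n = 1
    forces Re u = 1.\<close>
  have root: "u = 1 \<and> suminf b = c" if "cmod u \<le> 1" "poly P u = 0" for u
  proof -
    have Qu: "Q u = of_real c" using P[OF that(1)] r'[OF that(1)] that(2) by simp
    have "(\<lambda>n. Re (of_real (b n) * u ^ n)) sums Re (Q u)" by (rule sums_Re[OF Qs(1)[OF that(1)]])
    then have "(\<lambda>n. b n - b n * Re (u ^ n)) sums (suminf b - c)"
      using b_sum(1) by (intro sums_diff) (auto simp: Qu)
    moreover have t: "0 \<le> b n - b n * Re (u ^ n)" for n
    proof -
      have "Re (u ^ n) \<le> cmod (u ^ n)" by (rule complex_Re_le_cmod)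
      also have "\<dots> \<le> 1" using that(1) by (simp add: norm_power power_le_one)
      finally have "b n * Re (u ^ n) \<le> b n * 1" by (intro mult_left_mono b(1))
      then show ?thesis by simp
    qed
    ultimately have *: "b 1 - b 1 * Re (u ^ 1) \<le> suminf b - c" "0 \<le> suminf b - c"
      using sum_le_suminf[of "\<lambda>n. b n - b n * Re (u ^ n)" "{1}"] suminf_nonneg[of "\<lambda>n. b n - b n * Re (u ^ n)"]
      by (auto simp: sums_iff)
    then have S: "suminf b = c" using b_sum(2) by simp
    with * have "b 1 * 1 \<le> b 1 * Re u" by simp
    then have "1 \<le> Re u" using b(3) by (simp only: mult_le_cancel_left_pos)
    moreover have "(Re u)\<^sup>2 + (Im u)\<^sup>2 \<le> 1"
      using that(1) by (simp add: cmod_power2[symmetric] power_le_one)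
    moreover from \<open>1 \<le> Re u\<close> have "1 \<le> (Re u)\<^sup>2" by (rule one_le_power)
    ultimately have "(Im u)\<^sup>2 = 0" "(Re u)\<^sup>2 = 1" by (smt (verit) zero_le_power2)+
    then have "u = 1" using \<open>1 \<le> Re u\<close> by (auto simp: complex_eq_iff power2_eq_1_iff)
    with S show ?thesis by simp
  qed
  have "poly P 1 = 0 \<and> suminf b = c"
  proof (rule ccontr)
    assume "\<not> ?thesis"
    then have "poly P u \<noteq> 0" if "cmod u \<le> 1" for u using root[OF that] by auto
    then obtain R where R: "R > 1" "\<And>u. u \<in> ball 0 R \<Longrightarrow> poly P u \<noteq> 0"
      by (rule poly_nonzero_larger_disc) auto
    have "(\<lambda>u. poly r' u / poly P u) holomorphic_on ball 0 R"
      using R(2) by (auto intro!: holomorphic_intros)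
    with R(1) f no_ext show False by (metis (no_types, lifting))
  qed
  then have P1: "poly P 1 = 0" and S: "suminf b = c" by auto
  obtain E where E: "P = [:-1, 1:] * E" using P1 by (metis dvdE poly_eq_0_iff_dvd)
  \<comment> \<open>This makes the zero at 1 simple. The term n = 1 gives c - Re Q(x) \<ge> b_1 (1 -
    x); dividing by 1 - x and letting x tend to 1 bounds the cofactor \<open>E\<close> from
    below.\<close>
  have "b 1 * cmod (poly r' 1) \<le> cmod (poly E 1)"
  proof (rule tendsto_le)
    show "((\<lambda>x. cmod (poly E (of_real x))) \<longlongrightarrow> cmod (poly E 1)) (at_left (1::real))"
      by (rule tendsto_eq_intros | simp)+
    show "((\<lambda>x. b 1 * cmod (poly r' (of_real x))) \<longlongrightarrow> b 1 * cmod (poly r' 1)) (at_left (1::real))"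
      by (rule tendsto_eq_intros | simp)+
    have "eventually (\<lambda>x::real. x \<in> {0<..<1}) (at_left 1)"
      by (rule eventually_at_left_real) simp
    then show "eventually (\<lambda>x. b 1 * cmod (poly r' (of_real x)) \<le> cmod (poly E (of_real x))) (at_left (1::real))"
    proof eventually_elim
      case (elim x)
      define z where "z = complex_of_real x"
      have z: "cmod z \<le> 1" using elim by (simp add: z_def)
      have "(\<lambda>n. Re (of_real (b n) * z ^ n)) sums Re (Q z)" by (rule sums_Re[OF Qs(1)[OF z]])
      then have "(\<lambda>n. b n - b n * x ^ n) sums (c - Re (Q z))"
        using b_sum(1) S by (intro sums_diff) (auto simp: z_def simp flip: of_real_power)
      then have "b 1 - b 1 * x ^ 1 \<le> c - Re (Q z)"
        using sum_le_suminf[of "\<lambda>n. b n - b n * x ^ n" "{1}"] b(1) elim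
        by (auto simp: sums_iff mult_left_le power_le_one)
      also have "\<dots> \<le> cmod (of_real c - Q z)"
        using complex_Re_le_cmod[of "of_real c - Q z"] by simp
      finally have "(1 - x) * b 1 * cmod (poly r' z) \<le> cmod (of_real c - Q z) * cmod (poly r' z)"
        by (intro mult_right_mono) (auto simp: algebra_simps)
      also have "\<dots> = cmod (poly P z)" using P[OF z] by (simp add: norm_mult mult.commute)
      also have "\<dots> = cmod (of_real (x - 1)) * cmod (poly E z)"
        by (simp add: E z_def norm_mult[symmetric] algebra_simps)
      also have "cmod (of_real (x - 1)) = 1 - x" using elim by (simp only: norm_of_real) simp
      finally have "(1 - x) * (b 1 * cmod (poly r' z)) \<le> (1 - x) * cmod (poly E z)" by (simp only: mult.assoc)
      then show ?case using elim by (simp add: z_def)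
    qed
  qed simp
  moreover have "0 < b 1 * cmod (poly r' 1)" using b(3) r'[of 1] by simp
  ultimately have E1: "poly E 1 \<noteq> 0" by auto
  have Enz: "poly E u \<noteq> 0" if "cmod u \<le> 1" for u
    using root[OF that] E1 E by auto
  then obtain R where R: "R > 1" "\<And>u. u \<in> ball 0 R \<Longrightarrow> poly E u \<noteq> 0"
    by (rule poly_nonzero_larger_disc) auto
  \<comment> \<open>The minus sign turns the factor u - 1 of \<open>P\<close> into 1 - u, so that
    \<open>h u / (1 - u)\<close> is the reciprocal of c - q.\<close>
  define h where "h u = - poly r' u / poly E u" for u
  have h: "h holomorphic_on ball 0 R"
    unfolding h_def using R(2) by (auto intro!: holomorphic_intros)
  define \<alpha> where "\<alpha> n = (\<Sum>k\<le>n. (deriv ^^ k) h 0 / fact k)" for n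
  have \<alpha>: "(\<lambda>n. \<alpha> n * u ^ n) sums (1 / (of_real c - poly p u / poly r u))" if u: "u \<in> unit_disc" for u
  proof -
    have "u \<noteq> 1" using u by auto
    then have "h u / (1 - u) = poly r' u / poly P u"
      using Enz[of u] u by (simp add: h_def E field_simps)
    then show ?thesis
      using simple_pole_coeffs(1)[OF R(1) h u] f[OF u] by (simp add: \<alpha>_def)
  qed
  have \<alpha>lim: "\<alpha> \<longlonglongrightarrow> h 1" unfolding \<alpha>_def by (rule simple_pole_coeffs(2)[OF R(1) h])
  have pos: "Im (\<alpha> n) = 0 \<and> 0 < Re (\<alpha> n)" for n
  proof (rule renewal_coeffs_pos[where b = b and c = c])
    show "of_real c * \<alpha> 0 = 1"
      by (rule reciprocal_powser_recursion(1)[where q = "\<lambda>u. poly p u / poly r u", OF q b(2) nz \<alpha>])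
    show "of_real c * \<alpha> (Suc n) = (\<Sum>k\<le>n. of_real (b (Suc k)) * \<alpha> (n - k))" for n
      by (rule reciprocal_powser_recursion(2)[where q = "\<lambda>u. poly p u / poly r u", OF q b(2) nz \<alpha>])
  qed (use b c in auto)
  have "(\<lambda>n. Re (\<alpha> n)) \<longlonglongrightarrow> Re (h 1)" "(\<lambda>n. Im (\<alpha> n)) \<longlonglongrightarrow> Im (h 1)"
    using \<alpha>lim by (auto intro: tendsto_intros)
  then have Re: "(\<lambda>n. Re (\<alpha> n)) \<longlonglongrightarrow> Re (h 1)" and Im: "Im (h 1) = 0"
    using pos LIMSEQ_unique[of "\<lambda>_. 0"] by auto
  have "0 \<le> Re (h 1)"
    by (rule tendsto_lowerbound[OF Re]) (use pos in \<open>auto intro!: always_eventually less_imp_le\<close>)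
  \<comment> \<open>A limit of positive numbers could still be 0; this is excluded because
    \<open>r'\<close> has no zero at 1.\<close>
  moreover have "h 1 \<noteq> 0" using E1 r'[of 1] by (simp add: h_def)
  ultimately have "0 < Re (h 1)" using Im by (auto simp: complex_eq_iff less_le)
  with Re pos obtain m M where "0 < m" "0 < M" "\<And>n. m \<le> Re (\<alpha> n)" "\<And>n. Re (\<alpha> n) \<le> M"
    using pos_seq_pos_limit_bounds[of "\<lambda>n. Re (\<alpha> n)"] by metis
  moreover have "of_real (Re (\<alpha> n)) = \<alpha> n" for n using pos by (simp add: complex_eq_iff)
  ultimately show thesis using \<alpha> by (intro that[of m M "\<lambda>n. Re (\<alpha> n)"]) auto
qed

section \<open>Comparison with the Hardy space\<close>

lemma H2_coeff_sums:
  assumes "f holomorphic_on unit_disc" "z \<in> unit_disc"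
  shows "(\<lambda>n. (deriv ^^ n) f 0 / of_nat (fact n) * z ^ n) sums f z"
  using holomorphic_power_series[OF assms] by simp

text \<open>The argument works with the admissible constants t in the definition of the norm. Adding
  t times the second kernel inequality gives domination by t M times the Szego kernel; adding s / m
  times the first leads back from the squared Hardy norm s. Square roots give the constants 1 / sqrt
  M and 1 / sqrt m.\<close>

lemma rkhs_equivalent_H2:
  assumes an: "\<forall>f \<in> rkhs k unit_disc. f holomorphic_on unit_disc"
    and m: "0 < m" "pos_kernel unit_disc (\<lambda>z w. k z w - of_real m * szego z w)"
    and M: "0 < M" "pos_kernel unit_disc (\<lambda>z w. of_real M * szego z w - k z w)"
  shows "rkhs k unit_disc = H2 \<and>
         (\<exists>A B::real. A > 0 \<and> B > 0 \<and>
            (\<forall>f \<in> H2. A * H2_norm f \<le> rkhs_norm k unit_disc f \<and> rkhs_norm k unit_disc f \<le> B * H2_norm f))"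
proof -
  define co where "co f n = (deriv ^^ n) f 0 / of_nat (fact n)" for f :: "complex \<Rightarrow> complex" and n
  define adm where "adm f t \<longleftrightarrow> 0 \<le> t \<and> pos_kernel unit_disc (\<lambda>x y. of_real t * k x y - f x * cnj (f y))"
    for f and t :: real
  have co: "(\<lambda>n. co f n * z ^ n) sums f z" if "f holomorphic_on unit_disc" "z \<in> unit_disc" for f z
    using H2_coeff_sums[OF that] by (simp only: co_def)
  have H2: "f \<in> H2 \<longleftrightarrow> f holomorphic_on unit_disc \<and> (\<forall>z. z \<notin> unit_disc \<longrightarrow> f z = 0) \<and>
      summable (\<lambda>n. (cmod (co f n))\<^sup>2)" for f
    by (simp only: H2_def co_def mem_Collect_eq)
  have nrm: "H2_norm f = sqrt (\<Sum>n. (cmod (co f n))\<^sup>2)" for f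
    by (simp only: H2_norm_def co_def)
  have upper: "summable (\<lambda>n. (cmod (co f n))\<^sup>2)" "(\<Sum>n. (cmod (co f n))\<^sup>2) \<le> t * M"
    if f: "f holomorphic_on unit_disc" and t: "adm f t" for f t
  proof -
    have "pos_kernel unit_disc (\<lambda>z w. of_real t * (of_real M * szego z w - k z w) + (of_real t * k z w - f z * cnj (f w)))"
      using t M(2) by (intro pos_kernel_add pos_kernel_scale) (auto simp: adm_def)
    then have "pos_kernel unit_disc (\<lambda>z w. of_real (t * M) * szego z w - f z * cnj (f w))"
      by (simp add: algebra_simps)
    then have le: "(\<Sum>n<N. (cmod (co f n))\<^sup>2) \<le> t * M" for N
      using t M(1) by (intro pos_kernel_szego_imp_coeffs[OF co[OF f]]) (auto simp: adm_def)
    show s: "summable (\<lambda>n. (cmod (co f n))\<^sup>2)"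
      by (rule summableI_nonneg_bounded[OF _ le]) simp
    show "(\<Sum>n. (cmod (co f n))\<^sup>2) \<le> t * M"
      by (rule suminf_le_const[OF s le])
  qed
  have lower: "adm f ((\<Sum>n. (cmod (co f n))\<^sup>2) / m)" if "f \<in> H2" for f
  proof -
    define s where "s = (\<Sum>n. (cmod (co f n))\<^sup>2)"
    have hf: "f holomorphic_on unit_disc" and sm: "summable (\<lambda>n. (cmod (co f n))\<^sup>2)"
      using that by (auto simp: H2)
    have s0: "0 \<le> s" unfolding s_def using sm by (intro suminf_nonneg) auto
    have "pos_kernel unit_disc (\<lambda>z w. of_real s * szego z w - f z * cnj (f w))"
      unfolding s_def by (rule pos_kernel_szego_minus_rank_one[OF co[OF hf] sm])
    then have "pos_kernel unit_disc (\<lambda>z w. of_real (s / m) * (k z w - of_real m * szego z w) +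
       (of_real s * szego z w - f z * cnj (f w)))"
      using s0 m by (intro pos_kernel_add pos_kernel_scale) auto
    also have "(\<lambda>z w. of_real (s / m) * (k z w - of_real m * szego z w) +
       (of_real s * szego z w - f z * cnj (f w))) = (\<lambda>z w. of_real (s / m) * k z w - f z * cnj (f w))"
      using m(1) by (intro ext) (simp add: field_simps)
    finally show ?thesis using s0 m(1) by (simp add: adm_def s_def)
  qed
  have rk: "f \<in> rkhs k unit_disc \<longleftrightarrow> (\<forall>z. z \<notin> unit_disc \<longrightarrow> f z = 0) \<and> (\<exists>t. adm f t)" for f
    by (simp add: rkhs_def adm_def)
  have rkn: "rkhs_norm k unit_disc f = Inf {sqrt t | t. adm f t}" for f
    by (simp add: rkhs_norm_def adm_def)
  have "rkhs k unit_disc = H2"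
  proof (intro equalityI subsetI)
    fix f assume "f \<in> rkhs k unit_disc"
    then obtain t where "f holomorphic_on unit_disc" "adm f t" "\<forall>z. z \<notin> unit_disc \<longrightarrow> f z = 0"
      using an by (auto simp: rk)
    with upper(1) show "f \<in> H2" by (simp add: H2)
  next
    fix f assume "f \<in> H2"
    then show "f \<in> rkhs k unit_disc" using lower[of f] by (auto simp: H2 rk)
  qed
  moreover have "1 / sqrt M * H2_norm f \<le> rkhs_norm k unit_disc f \<and> rkhs_norm k unit_disc f \<le> 1 / sqrt m * H2_norm f"
    if f: "f \<in> H2" for f
  proof
    have hf: "f holomorphic_on unit_disc" using f by (simp add: H2)
    show "1 / sqrt M * H2_norm f \<le> rkhs_norm k unit_disc f"
      unfolding rkn
    proof (rule cInf_greatest)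
      show "{sqrt t | t. adm f t} \<noteq> {}" using lower[OF f] by auto
      fix x assume "x \<in> {sqrt t | t. adm f t}"
      then obtain t where t: "x = sqrt t" "adm f t" by auto
      have "H2_norm f \<le> sqrt (t * M)"
        unfolding nrm by (intro real_sqrt_le_mono upper(2)[OF hf t(2)])
      then show "1 / sqrt M * H2_norm f \<le> x"
        using M(1) by (simp add: t(1) real_sqrt_mult field_simps)
    qed
    have "rkhs_norm k unit_disc f \<le> sqrt ((\<Sum>n. (cmod (co f n))\<^sup>2) / m)"
      unfolding rkn
    proof (rule cInf_lower)
      show "bdd_below {sqrt t | t. adm f t}"
        by (rule bdd_belowI[of _ 0]) (auto simp: adm_def)
    qed (use lower[OF f] in auto)
    then show "rkhs_norm k unit_disc f \<le> 1 / sqrt m * H2_norm f"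
      by (simp add: nrm real_sqrt_divide)
  qed
  ultimately show ?thesis
    using m(1) M(1) by (intro conjI exI[of _ "1 / sqrt M"] exI[of _ "1 / sqrt m"]) auto
qed

text \<open>Two points of modulus below sqrt R have a product of modulus below R, hence the radius.
  Analyticity in the conjugated variable comes from conjugating before and after.\<close>

lemma extends_to_larger_disc_radial:
  assumes "1 < R" and h: "h holomorphic_on ball 0 R"
    and k: "\<And>z w. z \<in> unit_disc \<Longrightarrow> w \<in> unit_disc \<Longrightarrow> k z w = h (z * cnj w)"
  shows "extends_to_larger_disc k"
proof -
  have R: "z * cnj w \<in> ball 0 R" if "z \<in> ball 0 (sqrt R)" "w \<in> ball 0 (sqrt R)" for z w
    using that assms(1) mult_strict_mono[of "cmod z" "sqrt R" "cmod w" "sqrt R"] by (simp add: norm_mult)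
  have "(\<lambda>z. h (z * cnj w)) holomorphic_on ball 0 (sqrt R)" if "w \<in> ball 0 (sqrt R)" for w
    using R[OF _ that] by (intro holomorphic_on_compose_gen[OF _ h, unfolded o_def] holomorphic_intros) auto
  moreover have "(\<lambda>w. cnj (h (z * cnj w))) holomorphic_on ball 0 (sqrt R)" if "z \<in> ball 0 (sqrt R)" for z
  proof -
    have "(\<lambda>w. h (z * w)) holomorphic_on ball 0 (sqrt R)"
      using R[OF that, of "cnj _"] by (intro holomorphic_on_compose_gen[OF _ h, unfolded o_def] holomorphic_intros) auto
    moreover have eq: "cnj ` ball 0 (sqrt R) = ball 0 (sqrt R)"
      by (auto simp: image_iff intro!: bexI[of _ "cnj _"])
    ultimately have "(cnj \<circ> (\<lambda>w. h (z * w)) \<circ> cnj) holomorphic_on ball 0 (sqrt R)"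
      by (intro holomorphic_on_compose_cnj_cnj) (simp_all only: eq open_ball)
    then show ?thesis by (simp add: o_def)
  qed
  ultimately show ?thesis
    unfolding extends_to_larger_disc_def
    using assms(1) k by (intro exI[of _ "sqrt R"] exI[of _ "\<lambda>z w. h (z * cnj w)"] conjI) auto
qed

theorem theorem1p9:
  fixes k :: "complex \<Rightarrow> complex \<Rightarrow> complex"
  assumes kernel: "pos_kernel unit_disc k"
    and analytic: "\<forall>f \<in> rkhs k unit_disc. f holomorphic_on unit_disc"
    and irred: "irreducible_kernel k"
    and pick: "complete_pick k"
    and rational: "\<exists>p r :: complex poly.
           (\<forall>z\<in>unit_disc. \<forall>w\<in>unit_disc. poly r (z * cnj w) \<noteq> 0 \<and>
              1 / k 0 0 - 1 / k z w = poly p (z * cnj w) / poly r (z * cnj w)) \<and>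
           deriv (\<lambda>x. poly p x / poly r x) 0 \<noteq> 0"
    and no_ext: "\<not> extends_to_larger_disc k"
  shows "rkhs k unit_disc = H2 \<and>
         (\<exists>A B::real. A > 0 \<and> B > 0 \<and>
            (\<forall>f \<in> H2. A * H2_norm f \<le> rkhs_norm k unit_disc f \<and> rkhs_norm k unit_disc f \<le> B * H2_norm f))"
proof -
  obtain p r :: "complex poly" where
    pr: "\<And>z w. z \<in> unit_disc \<Longrightarrow> w \<in> unit_disc \<Longrightarrow> poly r (z * cnj w) \<noteq> 0 \<and>
              1 / k 0 0 - 1 / k z w = poly p (z * cnj w) / poly r (z * cnj w)"
    and dq: "deriv (\<lambda>x. poly p x / poly r x) 0 \<noteq> 0"
    using rational by blast
  define q where "q = (\<lambda>x. poly p x / poly r x)"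
  have nzk: "k z w \<noteq> 0" if "z \<in> unit_disc" "w \<in> unit_disc" for z w
    using irred that by (auto simp: irreducible_kernel_def)
  define c where "c = 1 / Re (k 0 0)"
  have k00: "k 0 0 = of_real (Re (k 0 0))" "0 < Re (k 0 0)"
    using pos_kernel_diag[OF kernel, of 0] nzk[of 0 0]
    by (auto simp: complex_nonneg_Reals_iff complex_eq_iff less_le)
  have c: "0 < c" "1 / k 0 0 = of_real c"
    using k00(2) by (simp add: c_def, subst k00(1), simp add: c_def)
  have qk: "of_real c - q (z * cnj w) = 1 / k z w" if "z \<in> unit_disc" "w \<in> unit_disc" for z w
    using pr[OF that] c(2) by (simp add: q_def algebra_simps)
  \<comment> \<open>The hypotheses speak of pairs. A square root z of u, paired with w = cnj z,
    realises every u of the disc as z * cnj w and carries them over to functions of u.\<close>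
  have split: "\<exists>z. z \<in> unit_disc \<and> cnj z \<in> unit_disc \<and> u = z * cnj (cnj z)" if "u \<in> unit_disc" for u
  proof (intro exI[of _ "csqrt u"] conjI)
    have "(cmod (csqrt u))\<^sup>2 < 1\<^sup>2" using that by (simp add: norm_power[symmetric])
    then have "cmod (csqrt u) < 1" by (rule power2_less_imp_less) simp
    then show "csqrt u \<in> unit_disc" "cnj (csqrt u) \<in> unit_disc" by simp_all
    show "u = csqrt u * cnj (cnj (csqrt u))" using power2_csqrt[of u] by (simp add: power2_eq_square)
  qed
  have r: "poly r u \<noteq> 0" and nz: "q u \<noteq> of_real c" if u: "u \<in> unit_disc" for u
  proof -
    obtain z where z: "z \<in> unit_disc" "cnj z \<in> unit_disc" "u = z * cnj (cnj z)"
      using split[OF u] by blast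
    show "poly r u \<noteq> 0" using pr[OF z(1,2)] z(3) by simp
    show "q u \<noteq> of_real c" using qk[OF z(1,2)] nzk[OF z(1,2)] z(3) by auto
  qed
  have q0: "q 0 = 0" using qk[of 0 0] c(2) by simp
  have qhol: "q holomorphic_on unit_disc"
    unfolding q_def using r by (auto intro!: holomorphic_intros)
  define \<beta> where "\<beta> n = (deriv ^^ n) q 0 / fact n" for n
  have \<beta>: "(\<lambda>n. \<beta> n * u ^ n) sums q u" if "u \<in> unit_disc" for u
    using holomorphic_power_series[OF qhol that] by (simp add: \<beta>_def)
  \<comment> \<open>Evaluation at w = 0 together with q(0) = 0 gives the normalisation on which the
    Gram construction rests.\<close>
  have "k z 0 = k 0 0" if "z \<in> unit_disc" for z
  proof -
    have "1 / k z 0 = 1 / k 0 0" using qk[OF that, of 0] q0 c(2) by simp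
    then show ?thesis using nzk[OF that, of 0] nzk[of 0 0] by (simp add: field_simps)
  qed
  from complete_pick_pos_kernel[OF kernel irred pick this]
  have "pos_kernel unit_disc (\<lambda>z w. of_real c * (1 - k 0 0 / k z w))"
    using c(1) by (intro pos_kernel_scale) auto
  also have "?this \<longleftrightarrow> pos_kernel unit_disc (\<lambda>z w. q (z * cnj w))"
  proof (rule pos_kernel_cong)
    fix z w :: complex assume zw: "z \<in> unit_disc" "w \<in> unit_disc"
    have "q (z * cnj w) = of_real c - 1 / k z w" using qk[OF zw] by (simp add: algebra_simps)
    also have "\<dots> = of_real c * (1 - k 0 0 / k z w)"
      unfolding c(2)[symmetric] using nzk[of 0 0] by (simp add: right_diff_distrib)
    finally show "of_real c * (1 - k 0 0 / k z w) = q (z * cnj w)" ..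
  qed
  finally have "\<beta> n \<in> \<real>\<^sub>\<ge>\<^sub>0" for n
    using pos_kernel_radial_coeffs[OF \<beta>] by blast
  then have \<beta>nn: "0 \<le> Re (\<beta> n)" "\<beta> n = of_real (Re (\<beta> n))" for n
    by (auto simp: complex_nonneg_Reals_iff complex_eq_iff)
  define b where "b n = Re (\<beta> n)" for n
  have b: "0 \<le> b n" "\<beta> n = of_real (b n)" for n using \<beta>nn[of n] by (auto simp: b_def)
  have b0: "b 0 = 0" by (simp add: b_def \<beta>_def q0)
  have "\<beta> 1 \<noteq> 0" using dq by (simp add: \<beta>_def q_def)
  then have b1: "0 < b 1" using b[of 1] by (auto simp: less_le)
  have qb: "(\<lambda>n. of_real (b n) * u ^ n) sums (poly p u / poly r u)" if "u \<in> unit_disc" for u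
    using \<beta>[OF that] by (simp add: b(2) q_def)
  \<comment> \<open>With z = w = sqrt x, nonnegativity of 1 / k(z,z) gives q(x) \<le> c, and partial
    sums of nonnegative terms stay below q(x).\<close>
  have lt: "(\<Sum>n<N. b n * x ^ n) \<le> c" if x: "0 \<le> x" "x < 1" for x N
  proof -
    define z where "z = complex_of_real (sqrt x)"
    have z: "z \<in> unit_disc" using x by (simp add: z_def)
    have zz: "z * cnj z = of_real x" using x by (simp add: z_def flip: of_real_mult)
    have "(\<lambda>n. of_real (b n) * of_real x ^ n) sums q (of_real x)"
      using qb[of "of_real x"] x by (simp add: q_def)
    then have "(\<lambda>n. Re (of_real (b n) * of_real x ^ n)) sums Re (q (of_real x))" by (rule sums_Re)
    then have s: "(\<lambda>n. b n * x ^ n) sums Re (q (of_real x))" by (simp flip: of_real_power)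
    have "(\<Sum>n<N. b n * x ^ n) \<le> Re (q (of_real x))"
      using s b(1) x sum_le_suminf[of "\<lambda>n. b n * x ^ n" "{..<N}"] by (auto simp: sums_iff)
    also have "q (of_real x) = of_real c - 1 / k z z" using qk[OF z z] by (simp add: zz algebra_simps)
    also have "Re (of_real c - 1 / k z z) \<le> c"
      using pos_kernel_diag[OF kernel z] by (simp add: complex_nonneg_Reals_iff Re_divide)
    finally show ?thesis .
  qed
  have kq: "k z w = 1 / (of_real c - poly p (z * cnj w) / poly r (z * cnj w))"
    if "z \<in> unit_disc" "w \<in> unit_disc" for z w
    using qk[OF that] by (simp add: q_def)
  have no_ext': "\<not> (\<exists>R>1. \<exists>h. h holomorphic_on ball 0 R \<and>
       (\<forall>u\<in>unit_disc. h u = 1 / (of_real c - poly p u / poly r u)))"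
  proof
    assume "\<exists>R>1. \<exists>h. h holomorphic_on ball 0 R \<and>
       (\<forall>u\<in>unit_disc. h u = 1 / (of_real c - poly p u / poly r u))"
    then obtain R h where "R > 1" "h holomorphic_on ball 0 R"
      "\<forall>u\<in>unit_disc. h u = 1 / (of_real c - poly p u / poly r u)" by blast
    then have "extends_to_larger_disc k"
      using kq mult_cnj_in_disc by (intro extends_to_larger_disc_radial[of R h]) auto
    with no_ext show False by simp
  qed
  obtain a :: "nat \<Rightarrow> real" and m M where mM: "0 < m" "0 < M" "\<And>n. m \<le> a n" "\<And>n. a n \<le> M"
    and a: "\<And>u. u \<in> unit_disc \<Longrightarrow> (\<lambda>n. of_real (a n) * u ^ n) sums (1 / (of_real c - poly p u / poly r u))"
    using rational_reciprocal_coeffs[OF r qb b(1) b0 b1 c(1) lt nz[unfolded q_def] no_ext'] by metis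
  \<comment> \<open>The difference from the scaled Szego kernel is radial with coefficients
    \<open>a l - m\<close>, which are nonnegative; the upper comparison uses \<open>M - a l\<close>
    in the same way.\<close>
  have "pos_kernel unit_disc (\<lambda>z w. 1 / (of_real c - poly p (z * cnj w) / poly r (z * cnj w)) - of_real m * (1 / (1 - z * cnj w)))"
  proof (rule pos_kernel_radial[where g = "\<lambda>u. 1 / (of_real c - poly p u / poly r u) - of_real m * (1 / (1 - u))"])
    show "(\<lambda>l. of_real (a l - m) * u ^ l) sums (1 / (of_real c - poly p u / poly r u) - of_real m * (1 / (1 - u)))"
      if "u \<in> unit_disc" for u
      using sums_diff[OF a[OF that] sums_mult[OF geometric_sums_disc[OF that], of "of_real m"]]
      by (simp add: algebra_simps)
    show "of_real (a l - m) \<in> \<real>\<^sub>\<ge>\<^sub>0" for l using mM(3)[of l] by (simp del: of_real_diff)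
  qed
  also have "?this \<longleftrightarrow> pos_kernel unit_disc (\<lambda>z w. k z w - of_real m * szego z w)"
    by (rule pos_kernel_cong) (simp add: kq szego_def)
  finally have lower: "pos_kernel unit_disc (\<lambda>z w. k z w - of_real m * szego z w)" .
  have "pos_kernel unit_disc (\<lambda>z w. of_real M * (1 / (1 - z * cnj w)) - 1 / (of_real c - poly p (z * cnj w) / poly r (z * cnj w)))"
  proof (rule pos_kernel_radial[where g = "\<lambda>u. of_real M * (1 / (1 - u)) - 1 / (of_real c - poly p u / poly r u)"])
    show "(\<lambda>l. of_real (M - a l) * u ^ l) sums (of_real M * (1 / (1 - u)) - 1 / (of_real c - poly p u / poly r u))"
      if "u \<in> unit_disc" for u
      using sums_diff[OF sums_mult[OF geometric_sums_disc[OF that], of "of_real M"] a[OF that]]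
      by (simp add: algebra_simps)
    show "of_real (M - a l) \<in> \<real>\<^sub>\<ge>\<^sub>0" for l using mM(4)[of l] by (simp del: of_real_diff)
  qed
  also have "?this \<longleftrightarrow> pos_kernel unit_disc (\<lambda>z w. of_real M * szego z w - k z w)"
    by (rule pos_kernel_cong) (simp add: kq szego_def)
  finally show ?thesis
    using rkhs_equivalent_H2[OF analytic mM(1) lower mM(2)] by blast
qed

end
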